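(* Let $P$ be a Hopf algebra over a field $k$ with a bicovariant differential calculus $\Omega^*P$, and suppose that $P$ has a normalised left integral. Then the inclusion map $i:{}^{coP}(\Omega^*P)\to\Omega^*P$ of the left invariant forms induces an isomorphism $H(i):H^n({}^{coP}(\Omega^*P),\mathrm{d})\to{}^{coP}(H^n_{dR}(P))$ for every $n$. If $P$ is connected, then ${}^{coP}(H^n_{dR}(P))=H^n_{dR}(P)$.
   Context: All algebras and tensor products are over a field $k$. A differential calculus on an algebra $A$ is a differential graded algebra $\Omega A=\bigoplus_{n\ge0}\Omega^nA$ with $\Omega^0A=A$ and differential $\mathrm{d}$, such that every $\omega\in\Omega^1A$ is a finite sum $\sum_i a_i\,\mathrm{d}b_i$ with $a_i,b_i\in A$. Its cohomology is $H^*_{dR}(A)$. The tensor product calculus is $\Omega^n(P\otimes P)=\bigoplus_{r=0}^n\Omega^rP\otimes\Omega^{n-r}P$, with differential $\mathrm{d}\otimes\mathrm{id}+(-1)^r\,\mathrm{id}\otimes\mathrm{d}$ on $\Omega^rP\otimes\Omega^sP$. "Bicovariant" is in the sense of Woronowicz; the coproduct, regarded as a left coaction of $P$ on itself, is then differentiable, i.e. it extends to maps $\Delta_*:\Omega^nP\to\Omega^n(P\otimes P)$ commuting with $\mathrm{d}$. Composing with the projection $\Pi_0:\Omega^n(P\otimes P)\to P\otimes\Omega^nP$ gives a left $P$-coaction $\bar\lambda=\Pi_0\circ\Delta_*$ on $\Omega^nP$ (on 1-forms, $p\,\mathrm{d}q\mapsto p_{(1)}q_{(1)}\otimes p_{(2)}\,\mathrm{d}q_{(2)}$).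 The differential $\mathrm{d}$ is a left $P$-comodule map, and there is an induced left coaction $\tilde\lambda$ on $H^n_{dR}(P)$, $[\omega]\mapsto(\mathrm{id}\otimes[\,\cdot\,])\bar\lambda(\omega)$ (these facts are part of the set-up). For a left $P$-comodule $E$ with coaction $\rho_E$, ${}^{coP}E=\{e\in E:\rho_E(e)=1_P\otimes e\}$; here the coactions $\bar\lambda$ and $\tilde\lambda$ are used. A left integral on $P$ is a linear map $\int:P\to k$ with $(\int\otimes\mathrm{id})\Delta(p)=\int(p)\,1_P$ for all $p\in P$; it is normalised if $\int1_P=1$. $P$ is connected (with respect to its calculus) if $H^0_{dR}(P)=\ker(\mathrm{d}:P\to\Omega^1P)=k\,1_P$. *)

theory Defs
  imports "HOL-Algebra.Module" "HOL-Algebra.AbelCoset"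
begin

section \<open>Linear maps, quotients and tensor products\<close>

text \<open>
  Vector spaces over \<open>K\<close> are modules in the sense of HOL-Algebra. The \<open>mult\<close> and \<open>one\<close>
  fields of a module record carry information only when the record is used as an algebra;
  in the constructions below they are left undefined.
\<close>

definition module_hom ::
    "'k ring \<Rightarrow> ('k, 'a) module \<Rightarrow> ('k, 'b) module \<Rightarrow> ('a \<Rightarrow> 'b) set" where
  "module_hom K M N =
     {f \<in> carrier M \<rightarrow> carrier N.
        (\<forall>x\<in>carrier M. \<forall>y\<in>carrier M. f (x \<oplus>\<^bsub>M\<^esub> y) = f x \<oplus>\<^bsub>N\<^esub> f y) \<and>
        (\<forall>c\<in>carrier K. \<forall>x\<in>carrier M. f (c \<odot>\<^bsub>M\<^esub> x) = c \<odot>\<^bsub>N\<^esub> f x)}"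

definition module_iso ::
    "'k ring \<Rightarrow> ('k, 'a) module \<Rightarrow> ('k, 'b) module \<Rightarrow> ('a \<Rightarrow> 'b) set" where
  "module_iso K M N = {f \<in> module_hom K M N. bij_betw f (carrier M) (carrier N)}"

definition self_module :: "'k ring \<Rightarrow> ('k, 'k) module" where
  "self_module K =
     \<lparr>carrier = carrier K, mult = mult K, one = one K, zero = zero K, add = add K,
      smult = mult K\<rparr>"

definition quotient_module :: "('k, 'a) module \<Rightarrow> 'a set \<Rightarrow> ('k, 'a set) module" where
  "quotient_module M N =
     \<lparr>carrier = a_rcosets\<^bsub>M\<^esub> N, mult = undefined, one = undefined,
      zero = N, add = set_add M,
      smult = (\<lambda>c X. N <+>\<^bsub>M\<^esub> ((\<lambda>x. c \<odot>\<^bsub>M\<^esub> x) ` X))\<rparr>"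

definition span_submodule :: "'k ring \<Rightarrow> ('k, 'a) module \<Rightarrow> 'a set \<Rightarrow> 'a set" where
  "span_submodule K M X = \<Inter>{N. submodule N K M \<and> X \<subseteq> N}"

text \<open>The vector space with basis \<open>S\<close>: functions of finite support vanishing off \<open>S\<close>.\<close>

definition free_module :: "'k ring \<Rightarrow> 's set \<Rightarrow> ('k, 's \<Rightarrow> 'k) module" where
  "free_module K S =
     \<lparr>carrier = {u. (\<forall>s\<in>S. u s \<in> carrier K) \<and> (\<forall>s. s \<notin> S \<longrightarrow> u s = \<zero>\<^bsub>K\<^esub>) \<and>
                    finite {s. u s \<noteq> \<zero>\<^bsub>K\<^esub>}},
      mult = undefined, one = undefined,
      zero = (\<lambda>s. \<zero>\<^bsub>K\<^esub>), add = (\<lambda>u v s. u s \<oplus>\<^bsub>K\<^esub> v s),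
      smult = (\<lambda>c u s. c \<otimes>\<^bsub>K\<^esub> u s)\<rparr>"

definition free_gen :: "'k ring \<Rightarrow> 's \<Rightarrow> 's \<Rightarrow> 'k" where
  "free_gen K s = (\<lambda>t. if t = s then \<one>\<^bsub>K\<^esub> else \<zero>\<^bsub>K\<^esub>)"

type_synonym ('k, 'a, 'b) tensor = "('a \<times> 'b \<Rightarrow> 'k) set"

definition tensor_relations ::
    "'k ring \<Rightarrow> ('k, 'a) module \<Rightarrow> ('k, 'b) module \<Rightarrow> ('a \<times> 'b \<Rightarrow> 'k) set" where
  "tensor_relations K A B = (let F = free_module K (carrier A \<times> carrier B); e = free_gen K in
     {e (a \<oplus>\<^bsub>A\<^esub> a', b) \<ominus>\<^bsub>F\<^esub> (e (a, b) \<oplus>\<^bsub>F\<^esub> e (a', b)) | a a' b.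
        a \<in> carrier A \<and> a' \<in> carrier A \<and> b \<in> carrier B} \<union>
     {e (a, b \<oplus>\<^bsub>B\<^esub> b') \<ominus>\<^bsub>F\<^esub> (e (a, b) \<oplus>\<^bsub>F\<^esub> e (a, b')) | a b b'.
        a \<in> carrier A \<and> b \<in> carrier B \<and> b' \<in> carrier B} \<union>
     {e (c \<odot>\<^bsub>A\<^esub> a, b) \<ominus>\<^bsub>F\<^esub> (c \<odot>\<^bsub>F\<^esub> e (a, b)) | c a b.
        c \<in> carrier K \<and> a \<in> carrier A \<and> b \<in> carrier B} \<union>
     {e (a, c \<odot>\<^bsub>B\<^esub> b) \<ominus>\<^bsub>F\<^esub> (c \<odot>\<^bsub>F\<^esub> e (a, b)) | c a b.
        c \<in> carrier K \<and> a \<in> carrier A \<and> b \<in> carrier B})"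

definition tensor_null ::
    "'k ring \<Rightarrow> ('k, 'a) module \<Rightarrow> ('k, 'b) module \<Rightarrow> ('a \<times> 'b \<Rightarrow> 'k) set" where
  "tensor_null K A B =
     span_submodule K (free_module K (carrier A \<times> carrier B)) (tensor_relations K A B)"

definition tensor ::
    "'k ring \<Rightarrow> ('k, 'a) module \<Rightarrow> ('k, 'b) module \<Rightarrow> ('k, ('k, 'a, 'b) tensor) module" where
  "tensor K A B = quotient_module (free_module K (carrier A \<times> carrier B)) (tensor_null K A B)"

definition pure ::
    "'k ring \<Rightarrow> ('k, 'a) module \<Rightarrow> ('k, 'b) module \<Rightarrow> 'a \<Rightarrow> 'b \<Rightarrow> ('k, 'a, 'b) tensor" where
  "pure K A B a b =
     tensor_null K A B +>\<^bsub>free_module K (carrier A \<times> carrier B)\<^esub> free_gen K (a, b)"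

text \<open>The linear map on \<open>A \<otimes> B\<close> with \<open>a \<otimes> b \<mapsto> \<beta> a b\<close>, for bilinear \<open>\<beta>\<close>
  (existence and uniqueness are the universal property, proved in the next section).\<close>

definition tensor_lift ::
    "'k ring \<Rightarrow> ('k, 'a) module \<Rightarrow> ('k, 'b) module \<Rightarrow> ('k, 'c) module \<Rightarrow>
     ('a \<Rightarrow> 'b \<Rightarrow> 'c) \<Rightarrow> ('k, 'a, 'b) tensor \<Rightarrow> 'c" where
  "tensor_lift K A B W \<beta> =
     (THE f. f \<in> module_hom K (tensor K A B) W \<and> f \<in> extensional (carrier (tensor K A B)) \<and>
             (\<forall>a\<in>carrier A. \<forall>b\<in>carrier B. f (pure K A B a b) = \<beta> a b))"

definition tensor_map ::
    "'k ring \<Rightarrow> ('k, 'a) module \<Rightarrow> ('k, 'b) module \<Rightarrow> ('k, 'c) module \<Rightarrow> ('k, 'e) module \<Rightarrow>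
     ('a \<Rightarrow> 'c) \<Rightarrow> ('b \<Rightarrow> 'e) \<Rightarrow> ('k, 'a, 'b) tensor \<Rightarrow> ('k, 'c, 'e) tensor" where
  "tensor_map K A B C E f g =
     tensor_lift K A B (tensor K C E) (\<lambda>a b. pure K C E (f a) (g b))"

definition tensor_assoc ::
    "'k ring \<Rightarrow> ('k, 'a) module \<Rightarrow> ('k, 'b) module \<Rightarrow> ('k, 'c) module \<Rightarrow>
     ('k, ('k, 'a, 'b) tensor, 'c) tensor \<Rightarrow> ('k, 'a, ('k, 'b, 'c) tensor) tensor" where
  "tensor_assoc K A B C =
     (let T = tensor K A (tensor K B C) in
      tensor_lift K (tensor K A B) C T
        (\<lambda>x c. tensor_lift K A B T (\<lambda>a b. pure K A (tensor K B C) a (pure K B C b c)) x))"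

text \<open>For bilinear \<open>\<mu> : A \<times> M \<rightarrow> X\<close> and \<open>\<nu> : B \<times> N \<rightarrow> Y\<close>, the product
  \<open>(a \<otimes> b) \<cdot> (m \<otimes> n) = \<mu> a m \<otimes> \<nu> b n\<close> of \<open>A \<otimes> B\<close> and \<open>M \<otimes> N\<close> with values in \<open>X \<otimes> Y\<close>.\<close>

definition tensor_mult ::
    "'k ring \<Rightarrow> ('k, 'a) module \<Rightarrow> ('k, 'b) module \<Rightarrow> ('k, 'm) module \<Rightarrow> ('k, 'n) module \<Rightarrow>
     ('k, 'x) module \<Rightarrow> ('k, 'y) module \<Rightarrow> ('a \<Rightarrow> 'm \<Rightarrow> 'x) \<Rightarrow> ('b \<Rightarrow> 'n \<Rightarrow> 'y) \<Rightarrow>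
     ('k, 'a, 'b) tensor \<Rightarrow> ('k, 'm, 'n) tensor \<Rightarrow> ('k, 'x, 'y) tensor" where
  "tensor_mult K A B M N X Y \<mu> \<nu> s t =
     tensor_lift K A B (tensor K X Y) (\<lambda>a b. tensor_map K M N X Y (\<mu> a) (\<nu> b) t) s"

text \<open>The carrier is the full product, so this is the direct sum for finite \<open>I\<close>.\<close>

definition direct_sum :: "'i set \<Rightarrow> ('i \<Rightarrow> ('k, 'a) module) \<Rightarrow> ('k, 'i \<Rightarrow> 'a) module" where
  "direct_sum I M =
     \<lparr>carrier = (\<Pi>\<^sub>E i\<in>I. carrier (M i)), mult = undefined, one = undefined,
      zero = (\<lambda>i\<in>I. \<zero>\<^bsub>M i\<^esub>), add = (\<lambda>x y. \<lambda>i\<in>I. x i \<oplus>\<^bsub>M i\<^esub> y i),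
      smult = (\<lambda>c x. \<lambda>i\<in>I. c \<odot>\<^bsub>M i\<^esub> x i)\<rparr>"

definition bilinear ::
    "'k ring \<Rightarrow> ('k, 'a) module \<Rightarrow> ('k, 'b) module \<Rightarrow> ('k, 'c) module \<Rightarrow>
     ('a \<Rightarrow> 'b \<Rightarrow> 'c) \<Rightarrow> bool" where
  "bilinear K A B W \<beta> \<longleftrightarrow>
     (\<forall>a\<in>carrier A. \<beta> a \<in> module_hom K B W) \<and>
     (\<forall>b\<in>carrier B. (\<lambda>a. \<beta> a b) \<in> module_hom K A W)"


section \<open>The universal property of the tensor product\<close>

lemma module_homI:
  assumes "\<And>x. x \<in> carrier M \<Longrightarrow> f x \<in> carrier N"
    and "\<And>x y. \<lbrakk>x \<in> carrier M; y \<in> carrier M\<rbrakk> \<Longrightarrow> f (x \<oplus>\<^bsub>M\<^esub> y) = f x \<oplus>\<^bsub>N\<^esub> f y"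
    and "\<And>c x. \<lbrakk>c \<in> carrier K; x \<in> carrier M\<rbrakk> \<Longrightarrow> f (c \<odot>\<^bsub>M\<^esub> x) = c \<odot>\<^bsub>N\<^esub> f x"
  shows "f \<in> module_hom K M N"
  using assms by (auto simp: module_hom_def)

lemma module_homD:
  assumes "f \<in> module_hom K M N"
  shows "x \<in> carrier M \<Longrightarrow> f x \<in> carrier N"
    and "\<lbrakk>x \<in> carrier M; y \<in> carrier M\<rbrakk> \<Longrightarrow> f (x \<oplus>\<^bsub>M\<^esub> y) = f x \<oplus>\<^bsub>N\<^esub> f y"
    and "\<lbrakk>c \<in> carrier K; x \<in> carrier M\<rbrakk> \<Longrightarrow> f (c \<odot>\<^bsub>M\<^esub> x) = c \<odot>\<^bsub>N\<^esub> f x"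
  using assms by (auto simp: module_hom_def)

lemma module_hom_zero:
  assumes "module K M" "module K N" "f \<in> module_hom K M N"
  shows "f \<zero>\<^bsub>M\<^esub> = \<zero>\<^bsub>N\<^esub>"
proof -
  interpret K: cring K using assms(1) by (simp add: module_def)
  interpret M: module K M by fact
  interpret N: module K N by fact
  have "f (\<zero>\<^bsub>K\<^esub> \<odot>\<^bsub>M\<^esub> \<zero>\<^bsub>M\<^esub>) = \<zero>\<^bsub>K\<^esub> \<odot>\<^bsub>N\<^esub> f \<zero>\<^bsub>M\<^esub>"
    by (rule module_homD(3)[OF assms(3)]) auto
  then show ?thesis using module_homD(1)[OF assms(3)] by simp
qed

lemma module_hom_neg:
  assumes "module K M" "module K N" "f \<in> module_hom K M N" "x \<in> carrier M"
  shows "f (\<ominus>\<^bsub>M\<^esub> x) = \<ominus>\<^bsub>N\<^esub> f x"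
proof -
  interpret K: cring K using assms(1) by (simp add: module_def)
  interpret M: module K M by fact
  interpret N: module K N by fact
  have "f (\<ominus>\<^bsub>M\<^esub> x) = f ((\<ominus>\<^bsub>K\<^esub> \<one>\<^bsub>K\<^esub>) \<odot>\<^bsub>M\<^esub> x)"
    using assms(4) by (simp add: M.smult_l_minus)
  also have "\<dots> = (\<ominus>\<^bsub>K\<^esub> \<one>\<^bsub>K\<^esub>) \<odot>\<^bsub>N\<^esub> f x"
    by (rule module_homD(3)[OF assms(3)]) (use assms(4) in auto)
  also have "\<dots> = \<ominus>\<^bsub>N\<^esub> f x"
    using module_homD(1)[OF assms(3,4)] by (simp add: N.smult_l_minus)
  finally show ?thesis .
qed

lemma module_hom_kernel:
  assumes "module K M" "module K N" "f \<in> module_hom K M N"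
  shows "submodule {x \<in> carrier M. f x = \<zero>\<^bsub>N\<^esub>} K M"
proof -
  interpret M: module K M by fact
  interpret N: module K N by fact
  show ?thesis
    by (rule M.submoduleI)
      (auto simp: module_hom_zero[OF assms] module_hom_neg[OF assms] module_homD[OF assms(3)])
qed

lemma free_module_module:
  assumes "cring K"
  shows "module K (free_module K S)"
proof -
  interpret K: cring K by fact
  let ?F = "free_module K S"
  have fin: "finite {s. u s \<oplus>\<^bsub>K\<^esub> v s \<noteq> \<zero>\<^bsub>K\<^esub>}"
    if "finite {s. u s \<noteq> \<zero>\<^bsub>K\<^esub>}" "finite {s. v s \<noteq> \<zero>\<^bsub>K\<^esub>}" for u v :: "'b \<Rightarrow> 'a"
    by (rule finite_subset[OF _ finite_UnI[OF that]]) auto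
  have fin2: "finite {s. c \<otimes>\<^bsub>K\<^esub> u s \<noteq> \<zero>\<^bsub>K\<^esub>}"
    if "finite {s. u s \<noteq> \<zero>\<^bsub>K\<^esub>}" "c \<in> carrier K" for u :: "'b \<Rightarrow> 'a" and c
    by (rule finite_subset[OF _ that(1)]) (use that(2) in auto)
  have cl: "u s \<in> carrier K" if "u \<in> carrier ?F" for u s
    using that by (cases "s \<in> S") (auto simp: free_module_def)
  have "abelian_group ?F"
  proof (rule abelian_groupI)
    fix u v assume u: "u \<in> carrier ?F" and v: "v \<in> carrier ?F"
    show "u \<oplus>\<^bsub>?F\<^esub> v \<in> carrier ?F"
      using u v fin by (auto simp: free_module_def)
    show "u \<oplus>\<^bsub>?F\<^esub> v = v \<oplus>\<^bsub>?F\<^esub> u"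
      using cl[OF u] cl[OF v] by (auto simp: free_module_def K.a_comm)
    fix z assume z: "z \<in> carrier ?F"
    show "u \<oplus>\<^bsub>?F\<^esub> v \<oplus>\<^bsub>?F\<^esub> z = u \<oplus>\<^bsub>?F\<^esub> (v \<oplus>\<^bsub>?F\<^esub> z)"
      using cl[OF u] cl[OF v] cl[OF z] by (auto simp: free_module_def K.a_assoc)
  next
    show "\<zero>\<^bsub>?F\<^esub> \<in> carrier ?F" by (simp add: free_module_def)
  next
    fix u assume u: "u \<in> carrier ?F"
    show "\<zero>\<^bsub>?F\<^esub> \<oplus>\<^bsub>?F\<^esub> u = u" using cl[OF u] by (simp add: free_module_def)
    have "(\<lambda>s. (\<ominus>\<^bsub>K\<^esub> \<one>\<^bsub>K\<^esub>) \<otimes>\<^bsub>K\<^esub> u s) \<in> carrier ?F"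
      using u fin2[of u "\<ominus>\<^bsub>K\<^esub> \<one>\<^bsub>K\<^esub>"] by (auto simp: free_module_def)
    moreover have "(\<lambda>s. (\<ominus>\<^bsub>K\<^esub> \<one>\<^bsub>K\<^esub>) \<otimes>\<^bsub>K\<^esub> u s) \<oplus>\<^bsub>?F\<^esub> u = \<zero>\<^bsub>?F\<^esub>"
      using cl[OF u] by (auto simp: free_module_def K.l_minus K.l_neg)
    ultimately show "\<exists>v\<in>carrier ?F. v \<oplus>\<^bsub>?F\<^esub> u = \<zero>\<^bsub>?F\<^esub>" by blast
  qed
  then show ?thesis
  proof (rule moduleI[OF assms])
    fix c u assume c: "c \<in> carrier K" and u: "u \<in> carrier ?F"
    show "c \<odot>\<^bsub>?F\<^esub> u \<in> carrier ?F"
      using u c fin2 by (auto simp: free_module_def)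
    fix b assume b: "b \<in> carrier K"
    show "(c \<oplus>\<^bsub>K\<^esub> b) \<odot>\<^bsub>?F\<^esub> u = c \<odot>\<^bsub>?F\<^esub> u \<oplus>\<^bsub>?F\<^esub> b \<odot>\<^bsub>?F\<^esub> u"
      using cl[OF u] b c by (simp add: free_module_def K.l_distr)
    show "(c \<otimes>\<^bsub>K\<^esub> b) \<odot>\<^bsub>?F\<^esub> u = c \<odot>\<^bsub>?F\<^esub> (b \<odot>\<^bsub>?F\<^esub> u)"
      using cl[OF u] b c by (simp add: free_module_def K.m_assoc)
  next
    fix u assume u: "u \<in> carrier ?F"
    show "\<one>\<^bsub>K\<^esub> \<odot>\<^bsub>?F\<^esub> u = u" using cl[OF u] by (simp add: free_module_def)
  next
    fix c u v assume c: "c \<in> carrier K" and u: "u \<in> carrier ?F" and v: "v \<in> carrier ?F"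
    show "c \<odot>\<^bsub>?F\<^esub> (u \<oplus>\<^bsub>?F\<^esub> v) = c \<odot>\<^bsub>?F\<^esub> u \<oplus>\<^bsub>?F\<^esub> c \<odot>\<^bsub>?F\<^esub> v"
      using cl[OF u] cl[OF v] c by (simp add: free_module_def K.r_distr)
  qed
qed

lemma free_gen_carrier:
  assumes "cring K" "s \<in> S"
  shows "free_gen K s \<in> carrier (free_module K S)"
proof -
  interpret K: cring K by fact
  have "finite {t. free_gen K s t \<noteq> \<zero>\<^bsub>K\<^esub>}"
    by (rule finite_subset[of _ "{s}"]) (auto simp: free_gen_def)
  then show ?thesis using assms(2) by (auto simp: free_module_def free_gen_def)
qed

lemma free_module_induct [consumes 2, case_names zero step]:
  assumes "cring K" "u \<in> carrier (free_module K S)" "P \<zero>\<^bsub>free_module K S\<^esub>"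
    and step: "\<And>v c s. \<lbrakk>v \<in> carrier (free_module K S); P v; c \<in> carrier K; s \<in> S\<rbrakk> \<Longrightarrow>
      P (v \<oplus>\<^bsub>free_module K S\<^esub> (c \<odot>\<^bsub>free_module K S\<^esub> free_gen K s))"
  shows "P u"
proof -
  interpret K: cring K by fact
  have "finite {s. u s \<noteq> \<zero>\<^bsub>K\<^esub>}" using assms(2) by (simp add: free_module_def)
  moreover have "finite X \<Longrightarrow> u \<in> carrier (free_module K S) \<Longrightarrow> {s. u s \<noteq> \<zero>\<^bsub>K\<^esub>} = X \<Longrightarrow> P u" for X u
  proof (induction X arbitrary: u rule: finite_induct)
    case empty
    then have "u = \<zero>\<^bsub>free_module K S\<^esub>" by (auto simp: free_module_def)
    then show ?case using assms(3) by simp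
  next
    case (insert s X)
    let ?v = "u(s := \<zero>\<^bsub>K\<^esub>)"
    have sS: "s \<in> S" using insert.prems by (auto simp: free_module_def)
    have supp: "{t. ?v t \<noteq> \<zero>\<^bsub>K\<^esub>} = X" using insert.prems(2) insert.hyps(2) by auto
    have v: "?v \<in> carrier (free_module K S)"
      using insert.prems(1) insert.hyps(1) supp by (auto simp: free_module_def)
    have us: "u t \<in> carrier K" for t
      using insert.prems(1) by (cases "t \<in> S") (auto simp: free_module_def)
    have "u = ?v \<oplus>\<^bsub>free_module K S\<^esub> (u s \<odot>\<^bsub>free_module K S\<^esub> free_gen K s)"
      using us by (auto simp: free_module_def free_gen_def fun_eq_iff)
    with step[OF v insert.IH[OF v supp] us[of s] sS] show ?case by metis
  qed
  ultimately show ?thesis using assms(2) by blast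
qed

definition free_lift :: "('k, 'b) module \<Rightarrow> 'k ring \<Rightarrow> ('s \<Rightarrow> 'b) \<Rightarrow> ('s \<Rightarrow> 'k) \<Rightarrow> 'b" where
  "free_lift W K \<beta> u = (\<Oplus>\<^bsub>W\<^esub>s\<in>{s. u s \<noteq> \<zero>\<^bsub>K\<^esub>}. u s \<odot>\<^bsub>W\<^esub> \<beta> s)"

lemma free_lift:
  assumes "module K W" and \<beta>: "\<And>s. s \<in> S \<Longrightarrow> \<beta> s \<in> carrier W"
  shows "free_lift W K \<beta> \<in> module_hom K (free_module K S) W"
    and "s \<in> S \<Longrightarrow> free_lift W K \<beta> (free_gen K s) = \<beta> s"
proof -
  interpret W: module K W by fact
  interpret K: cring K using assms(1) by (simp add: module_def)
  let ?F = "free_module K S"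
  have cl: "u s \<in> carrier K" if "u \<in> carrier ?F" for u s
    using that by (cases "s \<in> S") (auto simp: free_module_def)
  have ext: "free_lift W K \<beta> u = (\<Oplus>\<^bsub>W\<^esub>s\<in>X. u s \<odot>\<^bsub>W\<^esub> \<beta> s)"
    if u: "u \<in> carrier ?F" and X: "finite X" "{s. u s \<noteq> \<zero>\<^bsub>K\<^esub>} \<subseteq> X" "X \<subseteq> S" for u X
    unfolding free_lift_def
    by (rule W.add.finprod_mono_neutral_cong_left) (use X cl[OF u] \<beta> in auto)
  have fin: "finite {s. u s \<noteq> \<zero>\<^bsub>K\<^esub>}" "{s. u s \<noteq> \<zero>\<^bsub>K\<^esub>} \<subseteq> S" if "u \<in> carrier ?F" for u
    using that by (auto simp: free_module_def)
  show "free_lift W K \<beta> \<in> module_hom K ?F W"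
  proof (rule module_homI)
    fix u assume u: "u \<in> carrier ?F"
    show "free_lift W K \<beta> u \<in> carrier W"
      unfolding free_lift_def using cl[OF u] fin[OF u] \<beta> by (auto intro!: W.finsum_closed)
    fix v assume v: "v \<in> carrier ?F"
    let ?X = "{s. u s \<noteq> \<zero>\<^bsub>K\<^esub>} \<union> {s. v s \<noteq> \<zero>\<^bsub>K\<^esub>}"
    interpret F: module K ?F by (rule free_module_module) (rule W.R.cring_axioms)
    have X: "finite ?X" "?X \<subseteq> S" using fin[OF u] fin[OF v] by auto
    have "free_lift W K \<beta> (u \<oplus>\<^bsub>?F\<^esub> v) = (\<Oplus>\<^bsub>W\<^esub>s\<in>?X. (u s \<oplus>\<^bsub>K\<^esub> v s) \<odot>\<^bsub>W\<^esub> \<beta> s)"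
      by (subst ext[OF _ X(1) _ X(2)]) (use u v F.add.m_closed[OF u v] in \<open>auto simp: free_module_def\<close>)
    also have "\<dots> = (\<Oplus>\<^bsub>W\<^esub>s\<in>?X. u s \<odot>\<^bsub>W\<^esub> \<beta> s \<oplus>\<^bsub>W\<^esub> v s \<odot>\<^bsub>W\<^esub> \<beta> s)"
      by (rule W.finsum_cong') (use cl[OF u] cl[OF v] X \<beta> in \<open>auto simp: W.smult_l_distr subset_iff\<close>)
    also have "\<dots> = (\<Oplus>\<^bsub>W\<^esub>s\<in>?X. u s \<odot>\<^bsub>W\<^esub> \<beta> s) \<oplus>\<^bsub>W\<^esub> (\<Oplus>\<^bsub>W\<^esub>s\<in>?X. v s \<odot>\<^bsub>W\<^esub> \<beta> s)"
      by (rule W.finsum_addf) (use cl[OF u] cl[OF v] X \<beta> in auto)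
    also have "\<dots> = free_lift W K \<beta> u \<oplus>\<^bsub>W\<^esub> free_lift W K \<beta> v"
      using ext[OF u X(1) _ X(2)] ext[OF v X(1) _ X(2)] by auto
    finally show "free_lift W K \<beta> (u \<oplus>\<^bsub>?F\<^esub> v) = free_lift W K \<beta> u \<oplus>\<^bsub>W\<^esub> free_lift W K \<beta> v" .
  next
    fix c u assume c: "c \<in> carrier K" and u: "u \<in> carrier ?F"
    interpret F: module K ?F by (rule free_module_module) (rule W.R.cring_axioms)
    let ?X = "{s. u s \<noteq> \<zero>\<^bsub>K\<^esub>}"
    have "free_lift W K \<beta> (c \<odot>\<^bsub>?F\<^esub> u) = (\<Oplus>\<^bsub>W\<^esub>s\<in>?X. (c \<odot>\<^bsub>?F\<^esub> u) s \<odot>\<^bsub>W\<^esub> \<beta> s)"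
      by (rule ext) (use c fin[OF u] F.smult_closed[OF c u] in \<open>auto simp: free_module_def\<close>)
    also have "\<dots> = (\<Oplus>\<^bsub>W\<^esub>s\<in>?X. c \<odot>\<^bsub>W\<^esub> (u s \<odot>\<^bsub>W\<^esub> \<beta> s))"
      by (rule W.finsum_cong') (use c cl[OF u] fin[OF u] \<beta> in \<open>auto simp: W.smult_assoc1 subset_iff free_module_def\<close>)
    also have "\<dots> = c \<odot>\<^bsub>W\<^esub> free_lift W K \<beta> u"
      unfolding free_lift_def
      by (rule W.finsum_smult_ldistr[symmetric]) (use c cl[OF u] fin[OF u] \<beta> in auto)
    finally show "free_lift W K \<beta> (c \<odot>\<^bsub>?F\<^esub> u) = c \<odot>\<^bsub>W\<^esub> free_lift W K \<beta> u" .
  qed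
  assume s: "s \<in> S"
  have "free_lift W K \<beta> (free_gen K s) = (\<Oplus>\<^bsub>W\<^esub>t\<in>{s}. free_gen K s t \<odot>\<^bsub>W\<^esub> \<beta> t)"
    by (rule ext) (use s free_gen_carrier[OF W.R.cring_axioms s] in \<open>auto simp: free_gen_def\<close>)
  also have "\<dots> = \<beta> s" using \<beta>[OF s] by (simp add: free_gen_def)
  finally show "free_lift W K \<beta> (free_gen K s) = \<beta> s" .
qed

lemma span_submodule_submodule:
  assumes "module K M" "X \<subseteq> carrier M"
  shows "submodule (span_submodule K M X) K M" "X \<subseteq> span_submodule K M X"
proof -
  interpret M: module K M by fact
  have c: "submodule (carrier M) K M" by (rule M.carrier_is_submodule)
  show "X \<subseteq> span_submodule K M X" by (auto simp: span_submodule_def)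
  show "submodule (span_submodule K M X) K M"
  proof (rule M.submoduleI)
    show "span_submodule K M X \<subseteq> carrier M"
      using c assms(2) by (auto simp: span_submodule_def)
    show "\<zero>\<^bsub>M\<^esub> \<in> span_submodule K M X"
      by (auto simp: span_submodule_def dest!: submodule.axioms(1) subgroup.one_closed)
  qed (auto simp: span_submodule_def M.submoduleE)
qed

lemma span_submodule_least:
  "submodule N K M \<Longrightarrow> X \<subseteq> N \<Longrightarrow> span_submodule K M X \<subseteq> N"
  by (auto simp: span_submodule_def)

lemma quotient_module_ops:
  assumes "module K M" "submodule N K M"
  shows "carrier (quotient_module M N) = {N +>\<^bsub>M\<^esub> x | x. x \<in> carrier M}"
    and "\<lbrakk>x \<in> carrier M; y \<in> carrier M\<rbrakk> \<Longrightarrow>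
      (N +>\<^bsub>M\<^esub> x) \<oplus>\<^bsub>quotient_module M N\<^esub> (N +>\<^bsub>M\<^esub> y) = N +>\<^bsub>M\<^esub> (x \<oplus>\<^bsub>M\<^esub> y)"
    and "\<lbrakk>c \<in> carrier K; x \<in> carrier M\<rbrakk> \<Longrightarrow>
      c \<odot>\<^bsub>quotient_module M N\<^esub> (N +>\<^bsub>M\<^esub> x) = N +>\<^bsub>M\<^esub> (c \<odot>\<^bsub>M\<^esub> x)"
    and "\<zero>\<^bsub>quotient_module M N\<^esub> = N +>\<^bsub>M\<^esub> \<zero>\<^bsub>M\<^esub>"
    and "\<lbrakk>x \<in> carrier M; y \<in> carrier M\<rbrakk> \<Longrightarrow>
      N +>\<^bsub>M\<^esub> x = N +>\<^bsub>M\<^esub> y \<longleftrightarrow> x \<ominus>\<^bsub>M\<^esub> y \<in> N"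
proof -
  interpret M: module K M by fact
  interpret N: submodule N K M by fact
  interpret A: abelian_subgroup N M
    by (rule abelian_subgroupI3[OF additive_subgroup.intro[OF N.subgroup_axioms] M.abelian_group_axioms])
  have mem: "z \<in> N +>\<^bsub>M\<^esub> x \<longleftrightarrow> (\<exists>n\<in>N. z = n \<oplus>\<^bsub>M\<^esub> x)" for z x
    by (auto simp: a_r_coset_def r_coset_def)
  have add: "z \<in> X <+>\<^bsub>M\<^esub> Y \<longleftrightarrow> (\<exists>x\<in>X. \<exists>y\<in>Y. z = x \<oplus>\<^bsub>M\<^esub> y)" for z X Y
    by (auto simp: set_add_def set_mult_def)
  note sub = N.subset[simplified]
  show "carrier (quotient_module M N) = {N +>\<^bsub>M\<^esub> x | x. x \<in> carrier M}"
    by (auto simp: quotient_module_def A_RCOSETS_def RCOSETS_def a_r_coset_def)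
  show "(N +>\<^bsub>M\<^esub> x) \<oplus>\<^bsub>quotient_module M N\<^esub> (N +>\<^bsub>M\<^esub> y) = N +>\<^bsub>M\<^esub> (x \<oplus>\<^bsub>M\<^esub> y)"
    if "x \<in> carrier M" "y \<in> carrier M"
    using A.a_rcos_sum[OF that] by (simp add: quotient_module_def)
  show "\<zero>\<^bsub>quotient_module M N\<^esub> = N +>\<^bsub>M\<^esub> \<zero>\<^bsub>M\<^esub>"
    using sub by (force simp: quotient_module_def mem)
  show "N +>\<^bsub>M\<^esub> x = N +>\<^bsub>M\<^esub> y \<longleftrightarrow> x \<ominus>\<^bsub>M\<^esub> y \<in> N" if x: "x \<in> carrier M" and y: "y \<in> carrier M"
  proof
    assume "N +>\<^bsub>M\<^esub> x = N +>\<^bsub>M\<^esub> y"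
    moreover have "x \<in> N +>\<^bsub>M\<^esub> x" by (rule A.a_rcos_self[OF x])
    ultimately have "x \<in> N +>\<^bsub>M\<^esub> y" by simp
    then show "x \<ominus>\<^bsub>M\<^esub> y \<in> N" using A.a_rcos_module[OF y x] by (simp add: a_minus_def)
  next
    assume "x \<ominus>\<^bsub>M\<^esub> y \<in> N"
    then have "x \<in> N +>\<^bsub>M\<^esub> y" using A.a_rcos_module[OF y x] by (simp add: a_minus_def)
    then show "N +>\<^bsub>M\<^esub> x = N +>\<^bsub>M\<^esub> y" by (metis A.a_subgroup M.a_repr_independence y A.a_subgroup additive_subgroup.a_subgroup N.subgroup_axioms)
  qed
  show "c \<odot>\<^bsub>quotient_module M N\<^esub> (N +>\<^bsub>M\<^esub> x) = N +>\<^bsub>M\<^esub> (c \<odot>\<^bsub>M\<^esub> x)"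
    if c: "c \<in> carrier K" and x: "x \<in> carrier M"
  proof (intro subset_antisym subsetI)
    fix z assume "z \<in> c \<odot>\<^bsub>quotient_module M N\<^esub> (N +>\<^bsub>M\<^esub> x)"
    then obtain n m where nm: "n \<in> N" "m \<in> N" "z = n \<oplus>\<^bsub>M\<^esub> c \<odot>\<^bsub>M\<^esub> (m \<oplus>\<^bsub>M\<^esub> x)"
      by (auto simp: quotient_module_def add mem)
    then have "z = (n \<oplus>\<^bsub>M\<^esub> c \<odot>\<^bsub>M\<^esub> m) \<oplus>\<^bsub>M\<^esub> c \<odot>\<^bsub>M\<^esub> x"
      using c x sub by (auto simp: M.smult_r_distr M.a_assoc subset_iff)
    moreover have "n \<oplus>\<^bsub>M\<^esub> c \<odot>\<^bsub>M\<^esub> m \<in> N"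
      using nm c N.m_closed N.smult_closed by auto
    ultimately show "z \<in> N +>\<^bsub>M\<^esub> (c \<odot>\<^bsub>M\<^esub> x)" by (auto simp: mem)
  next
    fix z assume "z \<in> N +>\<^bsub>M\<^esub> (c \<odot>\<^bsub>M\<^esub> x)"
    then obtain n where n: "n \<in> N" "z = n \<oplus>\<^bsub>M\<^esub> c \<odot>\<^bsub>M\<^esub> x" by (auto simp: mem)
    have "x \<in> N +>\<^bsub>M\<^esub> x" by (rule A.a_rcos_self[OF x])
    then show "z \<in> c \<odot>\<^bsub>quotient_module M N\<^esub> (N +>\<^bsub>M\<^esub> x)"
      using n by (auto simp: quotient_module_def add)
  qed
qed

lemma quotient_module_module:
  assumes "module K M" "submodule N K M"
  shows "module K (quotient_module M N)"
proof -
  interpret M: module K M by fact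
  interpret N: submodule N K M by fact
  note q = quotient_module_ops[OF assms]
  show ?thesis
  proof (rule moduleI)
    show "cring K" by (rule M.R.cring_axioms)
    show "abelian_group (quotient_module M N)"
    proof (rule abelian_groupI)
      fix X assume "X \<in> carrier (quotient_module M N)"
      then obtain x where x: "x \<in> carrier M" "X = N +>\<^bsub>M\<^esub> x" by (auto simp: q(1))
      show "\<exists>Y\<in>carrier (quotient_module M N). Y \<oplus>\<^bsub>quotient_module M N\<^esub> X = \<zero>\<^bsub>quotient_module M N\<^esub>"
        by (rule bexI[of _ "N +>\<^bsub>M\<^esub> (\<ominus>\<^bsub>M\<^esub> x)"]) (use x in \<open>auto simp: q(1,2,4) M.l_neg\<close>)
        next
      fix X Y assume "X \<in> carrier (quotient_module M N)" "Y \<in> carrier (quotient_module M N)"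
      then obtain x y where x: "x \<in> carrier M" "X = N +>\<^bsub>M\<^esub> x" and y: "y \<in> carrier M" "Y = N +>\<^bsub>M\<^esub> y"
        by (auto simp: q(1))
      then show "X \<oplus>\<^bsub>quotient_module M N\<^esub> Y = Y \<oplus>\<^bsub>quotient_module M N\<^esub> X"
        using M.a_comm[OF x(1) y(1)] by (simp add: q(2))
      show "X \<oplus>\<^bsub>quotient_module M N\<^esub> Y \<in> carrier (quotient_module M N)"
        using x y by (auto simp: q(1,2))
    qed (auto simp: q(1,2,4) M.a_assoc)
    fix c X assume c: "c \<in> carrier K" and "X \<in> carrier (quotient_module M N)"
    then obtain x where x: "x \<in> carrier M" "X = N +>\<^bsub>M\<^esub> x" by (auto simp: q(1))
    show "c \<odot>\<^bsub>quotient_module M N\<^esub> X \<in> carrier (quotient_module M N)"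
      using M.smult_closed[OF c x(1)] c x by (auto simp: q(1) q(3))
  qed (auto simp: q(1,2,3) M.smult_l_distr M.smult_r_distr M.smult_assoc1)
qed

lemma tensor_facts:
  assumes A: "module K A" and B: "module K B"
  defines "F \<equiv> free_module K (carrier A \<times> carrier B)"
  shows "module K F" "tensor_relations K A B \<subseteq> carrier F" "submodule (tensor_null K A B) K F"
    "tensor_relations K A B \<subseteq> tensor_null K A B" "module K (tensor K A B)"
proof -
  interpret A: module K A by fact
  interpret B: module K B by fact
  show F: "module K F" unfolding F_def by (rule free_module_module) (rule A.R.cring_axioms)
  then interpret F: module K F .
  have g: "free_gen K s \<in> carrier F" if "s \<in> carrier A \<times> carrier B" for s
    unfolding F_def by (rule free_gen_carrier) (use that A.R.cring_axioms in auto)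
  show r: "tensor_relations K A B \<subseteq> carrier F"
    unfolding tensor_relations_def Let_def F_def[symmetric]
    by (auto intro!: g F.minus_closed F.add.m_closed F.smult_closed)
  show s: "submodule (tensor_null K A B) K F" "tensor_relations K A B \<subseteq> tensor_null K A B"
    unfolding tensor_null_def F_def[symmetric] using span_submodule_submodule[OF F r] by auto
  show "module K (tensor K A B)"
    unfolding tensor_def F_def[symmetric] using quotient_module_module[OF F s(1)] .
qed

lemma pure_bilinear:
  assumes A: "module K A" and B: "module K B"
  shows "bilinear K A B (tensor K A B) (pure K A B)"
proof -
  interpret A: module K A by fact
  interpret B: module K B by fact
  define F where "F = free_module K (carrier A \<times> carrier B)"
  note tf = tensor_facts[OF A B, folded F_def]
  interpret F: module K F by (rule tf)
  note q = quotient_module_ops[OF tf(1,3)]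
  have g: "free_gen K (a, b) \<in> carrier F" if "a \<in> carrier A" "b \<in> carrier B" for a b
    unfolding F_def by (rule free_gen_carrier) (use that A.R.cring_axioms in auto)
  let ?N = "tensor_null K A B"
  have eq: "?N +>\<^bsub>F\<^esub> x = ?N +>\<^bsub>F\<^esub> y"
    if "x \<ominus>\<^bsub>F\<^esub> y \<in> tensor_relations K A B" "x \<in> carrier F" "y \<in> carrier F" for x y
    using q(5)[OF that(2,3)] that(1) tf(4) by blast
  have p: "pure K A B a b = ?N +>\<^bsub>F\<^esub> free_gen K (a, b)" for a b by (simp add: pure_def F_def)
  have t: "tensor K A B = quotient_module F ?N" by (simp add: tensor_def F_def)
  note rel = tensor_relations_def[of K A B, unfolded Let_def, folded F_def]
  show ?thesis
    unfolding bilinear_def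
  proof (intro conjI ballI)
    fix a assume a: "a \<in> carrier A"
    show "pure K A B a \<in> module_hom K B (tensor K A B)"
    proof (rule module_homI)
      fix b assume b: "b \<in> carrier B"
      show "pure K A B a b \<in> carrier (tensor K A B)"
        unfolding t p q(1) using g[OF a b] by blast
      show "pure K A B a (b \<oplus>\<^bsub>B\<^esub> b') = pure K A B a b \<oplus>\<^bsub>tensor K A B\<^esub> pure K A B a b'"
        if b': "b' \<in> carrier B" for b'
        unfolding t p q(2)[OF g[OF a b] g[OF a b']]
        by (rule eq) (use a b b' g in \<open>unfold rel, blast+\<close>)
      show "pure K A B a (c \<odot>\<^bsub>B\<^esub> b) = c \<odot>\<^bsub>tensor K A B\<^esub> pure K A B a b"
        if c: "c \<in> carrier K" for c
        unfolding t p q(3)[OF c g[OF a b]]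
        by (rule eq) (use a b c g in \<open>unfold rel, blast+\<close>)
    qed
  next
    fix b assume b: "b \<in> carrier B"
    show "(\<lambda>a. pure K A B a b) \<in> module_hom K A (tensor K A B)"
    proof (rule module_homI)
      fix a assume a: "a \<in> carrier A"
      show "pure K A B a b \<in> carrier (tensor K A B)"
        unfolding t p q(1) using g[OF a b] by blast
      show "pure K A B (a \<oplus>\<^bsub>A\<^esub> a') b = pure K A B a b \<oplus>\<^bsub>tensor K A B\<^esub> pure K A B a' b"
        if a': "a' \<in> carrier A" for a'
        unfolding t p q(2)[OF g[OF a b] g[OF a' b]]
        by (rule eq) (use a b a' g in \<open>unfold rel, blast+\<close>)
      show "pure K A B (c \<odot>\<^bsub>A\<^esub> a) b = c \<odot>\<^bsub>tensor K A B\<^esub> pure K A B a b"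
        if c: "c \<in> carrier K" for c
        unfolding t p q(3)[OF c g[OF a b]]
        by (rule eq) (use a b c g in \<open>unfold rel, blast+\<close>)
    qed
  qed
qed

lemma tensor_induct [consumes 3, case_names zero step]:
  assumes A: "module K A" and B: "module K B" and x: "x \<in> carrier (tensor K A B)"
    and zero: "P \<zero>\<^bsub>tensor K A B\<^esub>"
    and step: "\<And>y a b. \<lbrakk>y \<in> carrier (tensor K A B); P y; a \<in> carrier A; b \<in> carrier B\<rbrakk> \<Longrightarrow>
      P (y \<oplus>\<^bsub>tensor K A B\<^esub> pure K A B a b)"
  shows "P x"
proof -
  interpret A: module K A by fact
  interpret B: module K B by fact
  define F where "F = free_module K (carrier A \<times> carrier B)"
  note tf = tensor_facts[OF A B, folded F_def]
  interpret F: module K F by (rule tf)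
  note q = quotient_module_ops[OF tf(1,3)]
  have g: "free_gen K (a, b) \<in> carrier F" if "a \<in> carrier A" "b \<in> carrier B" for a b
    unfolding F_def by (rule free_gen_carrier) (use that A.R.cring_axioms in auto)
  let ?q = "\<lambda>u. tensor_null K A B +>\<^bsub>F\<^esub> u"
  obtain u where u: "u \<in> carrier F" "x = ?q u"
    using x by (auto simp: tensor_def F_def[symmetric] q)
  have "P (?q u)" using A.R.cring_axioms u(1)[unfolded F_def]
  proof (induction u rule: free_module_induct)
    case zero
    then show ?case using \<open>P \<zero>\<^bsub>tensor K A B\<^esub>\<close> by (simp add: tensor_def F_def[symmetric] q)
  next
    case (step v c s)
    note c = \<open>c \<in> carrier K\<close> and v0 = step(1)[folded F_def] and IH = \<open>P (?q v)\<close>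
    obtain a b where s: "s = (a, b)" "a \<in> carrier A" "b \<in> carrier B" using step by auto
    have hom: "(\<lambda>a. pure K A B a b) \<in> module_hom K A (tensor K A B)"
      using pure_bilinear[OF A B] s by (auto simp: bilinear_def)
    have v: "?q v \<in> carrier (tensor K A B)"
      using v0 by (auto simp: tensor_def F_def[symmetric] q)
    have "?q (v \<oplus>\<^bsub>F\<^esub> c \<odot>\<^bsub>F\<^esub> free_gen K s) = ?q v \<oplus>\<^bsub>tensor K A B\<^esub> c \<odot>\<^bsub>tensor K A B\<^esub> ?q (free_gen K s)"
      using v0 c s g by (simp add: tensor_def F_def[symmetric] q)
    also have "\<dots> = ?q v \<oplus>\<^bsub>tensor K A B\<^esub> c \<odot>\<^bsub>tensor K A B\<^esub> pure K A B a b"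
      by (simp add: pure_def s F_def)
    also have "c \<odot>\<^bsub>tensor K A B\<^esub> pure K A B a b = pure K A B (c \<odot>\<^bsub>A\<^esub> a) b"
      using module_homD(3)[OF hom c s(2)] by simp
    finally show ?case
      using assms(5)[OF v IH, of "c \<odot>\<^bsub>A\<^esub> a" b] s c by (simp add: F_def)
  qed
  then show ?thesis using u by simp
qed

lemma tensor_lift:
  assumes A: "module K A" and B: "module K B" and W: "module K W"
    and \<beta>: "bilinear K A B W \<beta>"
  shows "tensor_lift K A B W \<beta> \<in> module_hom K (tensor K A B) W"
    and "\<lbrakk>a \<in> carrier A; b \<in> carrier B\<rbrakk> \<Longrightarrow> tensor_lift K A B W \<beta> (pure K A B a b) = \<beta> a b"
proof -
  interpret A: module K A by fact
  interpret B: module K B by fact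
  interpret W: module K W by fact
  define F where "F = free_module K (carrier A \<times> carrier B)"
  note tf = tensor_facts[OF A B, folded F_def]
  interpret F: module K F by (rule tf)
  note q = quotient_module_ops[OF tf(1,3)]
  have g: "free_gen K (a, b) \<in> carrier F" if "a \<in> carrier A" "b \<in> carrier B" for a b
    unfolding F_def by (rule free_gen_carrier) (use that A.R.cring_axioms in auto)
  let ?q = "\<lambda>u. tensor_null K A B +>\<^bsub>F\<^esub> u"
  have \<beta>l: "\<beta> a \<in> module_hom K B W" if "a \<in> carrier A" for a
    using \<beta> that by (auto simp: bilinear_def)
  have \<beta>r: "(\<lambda>a. \<beta> a b) \<in> module_hom K A W" if "b \<in> carrier B" for b
    using \<beta> that by (auto simp: bilinear_def)
  have cl: "\<beta> a b \<in> carrier W" if "a \<in> carrier A" "b \<in> carrier B" for a b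
    using module_homD(1)[OF \<beta>l] that by blast
  define L where "L = free_lift W K (case_prod \<beta>)"
  have L: "L \<in> module_hom K F W"
    unfolding F_def L_def by (rule free_lift) (use W cl in auto)
  have Lg: "L (free_gen K (a, b)) = \<beta> a b" if "a \<in> carrier A" "b \<in> carrier B" for a b
    unfolding L_def using free_lift(2)[OF W, of "carrier A \<times> carrier B" "case_prod \<beta>" "(a, b)"] cl that by auto
  note LD = module_homD[OF L] module_hom_neg[OF F.module_axioms W L]
  have Lm: "L (x \<ominus>\<^bsub>F\<^esub> y) = L x \<ominus>\<^bsub>W\<^esub> L y" if "x \<in> carrier F" "y \<in> carrier F" for x y
    using that by (simp add: a_minus_def LD)
  have "tensor_relations K A B \<subseteq> {x \<in> carrier F. L x = \<zero>\<^bsub>W\<^esub>}"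
  proof
    fix x assume x: "x \<in> tensor_relations K A B"
    then have "x \<in> carrier F" using tf(2) by blast
    moreover have "L x = \<zero>\<^bsub>W\<^esub>"
      using x unfolding tensor_relations_def Let_def F_def[symmetric]
      by (auto simp: Lm LD Lg g cl module_homD(2,3)[OF \<beta>l] module_homD(2,3)[OF \<beta>r]
          W.r_neg a_minus_def)
    ultimately show "x \<in> {x \<in> carrier F. L x = \<zero>\<^bsub>W\<^esub>}" by simp
  qed
  then have null: "tensor_null K A B \<subseteq> {x \<in> carrier F. L x = \<zero>\<^bsub>W\<^esub>}"
    unfolding tensor_null_def F_def[symmetric]
    by (rule span_submodule_least[OF module_hom_kernel[OF F.module_axioms W L]])
  have wd: "L x = L y" if "?q x = ?q y" "x \<in> carrier F" "y \<in> carrier F" for x y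
  proof -
    have "L (x \<ominus>\<^bsub>F\<^esub> y) = \<zero>\<^bsub>W\<^esub>" using null that q(5) by blast
    then show ?thesis using that LD(1) by (metis Lm W.add.inv_closed W.add.inv_solve_right' W.l_zero W.zero_closed a_minus_def)
  qed
  define f where "f = (\<lambda>X\<in>carrier (tensor K A B). L (SOME u. u \<in> carrier F \<and> X = ?q u))"
  have t: "tensor K A B = quotient_module F (tensor_null K A B)" by (simp add: tensor_def F_def)
  have ca: "carrier (tensor K A B) = ?q ` carrier F"
    unfolding t q(1) by blast
  have fq: "f (?q u) = L u" if "u \<in> carrier F" for u
  proof -
    define v where "v = (SOME v. v \<in> carrier F \<and> ?q u = ?q v)"
    have "v \<in> carrier F \<and> ?q u = ?q v"
      unfolding v_def by (rule someI[of _ u]) (use that in simp)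
    then have "L v = L u" using wd[of u v] that by simp
    moreover have "?q u \<in> carrier (tensor K A B)" using that unfolding ca by blast
    ultimately show ?thesis unfolding f_def v_def by (simp only: restrict_apply')
  qed
  have fhom: "f \<in> module_hom K (tensor K A B) W"
  proof (rule module_homI)
    fix X assume "X \<in> carrier (tensor K A B)"
    then obtain x where x: "x \<in> carrier F" "X = ?q x" unfolding ca by blast
    then show "f X \<in> carrier W" by (simp add: fq LD)
    { fix Y assume "Y \<in> carrier (tensor K A B)"
      then obtain y where y: "y \<in> carrier F" "Y = ?q y" unfolding ca by blast
      have "X \<oplus>\<^bsub>tensor K A B\<^esub> Y = ?q (x \<oplus>\<^bsub>F\<^esub> y)" using x y by (simp add: t q(2))
      then show "f (X \<oplus>\<^bsub>tensor K A B\<^esub> Y) = f X \<oplus>\<^bsub>W\<^esub> f Y" using x y by (simp add: fq LD) }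
    { fix c assume c: "c \<in> carrier K"
      have "c \<odot>\<^bsub>tensor K A B\<^esub> X = ?q (c \<odot>\<^bsub>F\<^esub> x)" using x c by (simp add: t q(3))
      then show "f (c \<odot>\<^bsub>tensor K A B\<^esub> X) = c \<odot>\<^bsub>W\<^esub> f X" using x c by (simp add: fq LD) }
  qed
  have fp: "f (pure K A B a b) = \<beta> a b" if "a \<in> carrier A" "b \<in> carrier B" for a b
    using that by (simp add: pure_def F_def[symmetric] fq g Lg)
  have pcl: "pure K A B a b \<in> carrier (tensor K A B)" if "a \<in> carrier A" "b \<in> carrier B" for a b
    unfolding pure_def F_def[symmetric] ca using g[OF that] by blast
  have "f' = f" if f': "f' \<in> module_hom K (tensor K A B) W"
    "f' \<in> extensional (carrier (tensor K A B))"
    "\<forall>a\<in>carrier A. \<forall>b\<in>carrier B. f' (pure K A B a b) = \<beta> a b" for f'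
  proof (rule extensionalityI[OF f'(2)])
    show "f \<in> extensional (carrier (tensor K A B))" by (simp add: f_def)
    fix x assume "x \<in> carrier (tensor K A B)"
    with A B show "f' x = f x"
    proof (induction x rule: tensor_induct)
      case zero
      then show ?case using module_hom_zero[OF tf(5) W] f'(1) fhom by metis
    next
      case (step y a b)
      then show ?case
        using module_homD(2)[OF f'(1)] module_homD(2)[OF fhom] pcl f'(3) fp by simp
    qed
  qed
  moreover have "f \<in> extensional (carrier (tensor K A B))"
    unfolding f_def by (rule restrict_extensional)
  ultimately have lift: "tensor_lift K A B W \<beta> = f"
    unfolding tensor_lift_def using fhom fp by (intro the_equality) blast+
  show "tensor_lift K A B W \<beta> \<in> module_hom K (tensor K A B) W"
    unfolding lift by (rule fhom)
  show "tensor_lift K A B W \<beta> (pure K A B a b) = \<beta> a b"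
    if "a \<in> carrier A" "b \<in> carrier B"
    unfolding lift by (rule fp[OF that])
qed


section \<open>Hopf algebras\<close>

locale assoc_algebra = module K A + ring A for K :: "'k ring" and A :: "('k, 'a) module" +
  assumes smult_mult_left:
      "\<lbrakk>c \<in> carrier K; x \<in> carrier A; y \<in> carrier A\<rbrakk> \<Longrightarrow>
       (c \<odot>\<^bsub>A\<^esub> x) \<otimes>\<^bsub>A\<^esub> y = c \<odot>\<^bsub>A\<^esub> (x \<otimes>\<^bsub>A\<^esub> y)"
    and smult_mult_right:
      "\<lbrakk>c \<in> carrier K; x \<in> carrier A; y \<in> carrier A\<rbrakk> \<Longrightarrow>
       x \<otimes>\<^bsub>A\<^esub> (c \<odot>\<^bsub>A\<^esub> y) = c \<odot>\<^bsub>A\<^esub> (x \<otimes>\<^bsub>A\<^esub> y)"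

locale hopf_algebra = field K + assoc_algebra K P
  for K :: "'k ring" and P :: "('k, 'a) module" +
  fixes \<Delta> :: "'a \<Rightarrow> ('k, 'a, 'a) tensor" and \<epsilon> :: "'a \<Rightarrow> 'k" and S :: "'a \<Rightarrow> 'a"
  assumes comult_hom: "\<Delta> \<in> module_hom K P (tensor K P P)"
    and counit_hom: "\<epsilon> \<in> module_hom K P (self_module K)"
    and antipode_hom: "S \<in> module_hom K P P"
    and coassoc:
      "p \<in> carrier P \<Longrightarrow>
       tensor_assoc K P P P (tensor_map K P P (tensor K P P) P \<Delta> id (\<Delta> p)) =
       tensor_map K P P P (tensor K P P) id \<Delta> (\<Delta> p)"
    and counit_left:
      "p \<in> carrier P \<Longrightarrow> tensor_lift K P P P (\<lambda>a b. \<epsilon> a \<odot>\<^bsub>P\<^esub> b) (\<Delta> p) = p"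
    and counit_right:
      "p \<in> carrier P \<Longrightarrow> tensor_lift K P P P (\<lambda>a b. \<epsilon> b \<odot>\<^bsub>P\<^esub> a) (\<Delta> p) = p"
    and comult_mult:
      "\<lbrakk>p \<in> carrier P; q \<in> carrier P\<rbrakk> \<Longrightarrow>
       \<Delta> (p \<otimes>\<^bsub>P\<^esub> q) = tensor_mult K P P P P P P (mult P) (mult P) (\<Delta> p) (\<Delta> q)"
    and comult_one: "\<Delta> \<one>\<^bsub>P\<^esub> = pure K P P \<one>\<^bsub>P\<^esub> \<one>\<^bsub>P\<^esub>"
    and counit_mult:
      "\<lbrakk>p \<in> carrier P; q \<in> carrier P\<rbrakk> \<Longrightarrow> \<epsilon> (p \<otimes>\<^bsub>P\<^esub> q) = \<epsilon> p \<otimes>\<^bsub>K\<^esub> \<epsilon> q"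
    and counit_one: "\<epsilon> \<one>\<^bsub>P\<^esub> = \<one>\<^bsub>K\<^esub>"
    and antipode_left:
      "p \<in> carrier P \<Longrightarrow>
       tensor_lift K P P P (\<lambda>a b. S a \<otimes>\<^bsub>P\<^esub> b) (\<Delta> p) = \<epsilon> p \<odot>\<^bsub>P\<^esub> \<one>\<^bsub>P\<^esub>"
    and antipode_right:
      "p \<in> carrier P \<Longrightarrow>
       tensor_lift K P P P (\<lambda>a b. a \<otimes>\<^bsub>P\<^esub> S b) (\<Delta> p) = \<epsilon> p \<odot>\<^bsub>P\<^esub> \<one>\<^bsub>P\<^esub>"

definition left_coaction ::
    "'k ring \<Rightarrow> ('k, 'a) module \<Rightarrow> ('a \<Rightarrow> ('k, 'a, 'a) tensor) \<Rightarrow> ('a \<Rightarrow> 'k) \<Rightarrow>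
     ('k, 'e) module \<Rightarrow> ('e \<Rightarrow> ('k, 'a, 'e) tensor) \<Rightarrow> bool" where
  "left_coaction K P \<Delta> \<epsilon> E \<rho> \<longleftrightarrow>
     \<rho> \<in> module_hom K E (tensor K P E) \<and>
     (\<forall>e\<in>carrier E.
        tensor_assoc K P P E (tensor_map K P E (tensor K P P) E \<Delta> id (\<rho> e)) =
        tensor_map K P E P (tensor K P E) id \<rho> (\<rho> e)) \<and>
     (\<forall>e\<in>carrier E. tensor_lift K P E E (\<lambda>p x. \<epsilon> p \<odot>\<^bsub>E\<^esub> x) (\<rho> e) = e)"

definition coinvariants ::
    "'k ring \<Rightarrow> ('k, 'a) module \<Rightarrow> ('k, 'e) module \<Rightarrow> ('e \<Rightarrow> ('k, 'a, 'e) tensor) \<Rightarrow>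
     'e set" where
  "coinvariants K P E \<rho> = {e \<in> carrier E. \<rho> e = pure K P E \<one>\<^bsub>P\<^esub> e}"

definition left_integral ::
    "'k ring \<Rightarrow> ('k, 'a) module \<Rightarrow> ('a \<Rightarrow> ('k, 'a, 'a) tensor) \<Rightarrow> ('a \<Rightarrow> 'k) \<Rightarrow> bool" where
  "left_integral K P \<Delta> I \<longleftrightarrow>
     I \<in> module_hom K P (self_module K) \<and>
     (\<forall>p\<in>carrier P. tensor_lift K P P P (\<lambda>a b. I a \<odot>\<^bsub>P\<^esub> b) (\<Delta> p) = I p \<odot>\<^bsub>P\<^esub> \<one>\<^bsub>P\<^esub>)"

definition normalised_left_integral ::
    "'k ring \<Rightarrow> ('k, 'a) module \<Rightarrow> ('a \<Rightarrow> ('k, 'a, 'a) tensor) \<Rightarrow> ('a \<Rightarrow> 'k) \<Rightarrow> bool" where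
  "normalised_left_integral K P \<Delta> I \<longleftrightarrow> left_integral K P \<Delta> I \<and> I \<one>\<^bsub>P\<^esub> = \<one>\<^bsub>K\<^esub>"


section \<open>Cochain complexes\<close>

definition cocycles ::
    "(nat \<Rightarrow> ('k, 'a) module) \<Rightarrow> (nat \<Rightarrow> 'a \<Rightarrow> 'a) \<Rightarrow> nat \<Rightarrow> 'a set" where
  "cocycles C d n = {x \<in> carrier (C n). d n x = \<zero>\<^bsub>C (Suc n)\<^esub>}"

definition coboundaries ::
    "(nat \<Rightarrow> ('k, 'a) module) \<Rightarrow> (nat \<Rightarrow> 'a \<Rightarrow> 'a) \<Rightarrow> nat \<Rightarrow> 'a set" where
  "coboundaries C d n = (case n of 0 \<Rightarrow> {\<zero>\<^bsub>C 0\<^esub>} | Suc m \<Rightarrow> d m ` carrier (C m))"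

definition cocycle_space ::
    "(nat \<Rightarrow> ('k, 'a) module) \<Rightarrow> (nat \<Rightarrow> 'a \<Rightarrow> 'a) \<Rightarrow> nat \<Rightarrow> ('k, 'a) module" where
  "cocycle_space C d n = (C n)\<lparr>carrier := cocycles C d n\<rparr>"

definition cohomology ::
    "(nat \<Rightarrow> ('k, 'a) module) \<Rightarrow> (nat \<Rightarrow> 'a \<Rightarrow> 'a) \<Rightarrow> nat \<Rightarrow> ('k, 'a set) module" where
  "cohomology C d n = quotient_module (cocycle_space C d n) (coboundaries C d n)"

definition cohomology_class ::
    "(nat \<Rightarrow> ('k, 'a) module) \<Rightarrow> (nat \<Rightarrow> 'a \<Rightarrow> 'a) \<Rightarrow> nat \<Rightarrow> 'a \<Rightarrow> 'a set" where
  "cohomology_class C d n x = coboundaries C d n +>\<^bsub>cocycle_space C d n\<^esub> x"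

definition cohomology_map ::
    "(nat \<Rightarrow> ('k, 'a) module) \<Rightarrow> (nat \<Rightarrow> 'a \<Rightarrow> 'a) \<Rightarrow>
     (nat \<Rightarrow> ('k, 'b) module) \<Rightarrow> (nat \<Rightarrow> 'b \<Rightarrow> 'b) \<Rightarrow>
     (nat \<Rightarrow> 'a \<Rightarrow> 'b) \<Rightarrow> nat \<Rightarrow> 'a set \<Rightarrow> 'b set" where
  "cohomology_map C d C' d' f n X =
     (THE Y. \<exists>x\<in>cocycles C d n. X = cohomology_class C d n x \<and>
                                Y = cohomology_class C' d' n (f n x))"


section \<open>Differential calculi\<close>

definition signed :: "('k, 'a) module \<Rightarrow> nat \<Rightarrow> 'a \<Rightarrow> 'a" where
  "signed M r x = (if even r then x else \<ominus>\<^bsub>M\<^esub> x)"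

text \<open>\<open>\<Omega> n\<close> is the space of \<open>n\<close>-forms, \<open>w m n\<close> is the product \<open>\<Omega> m \<times> \<Omega> n \<rightarrow> \<Omega> (m + n)\<close>.
  The graded algebra is thus given by its homogeneous components; they share an element type,
  but their carriers are unrelated, and only \<open>\<Omega> 0 = A\<close> uses the \<open>mult\<close> and \<open>one\<close> fields.\<close>

locale differential_calculus = assoc_algebra K A
  for K :: "'k ring" and A :: "('k, 'a) module" +
  fixes \<Omega> :: "nat \<Rightarrow> ('k, 'a) module"
    and w :: "nat \<Rightarrow> nat \<Rightarrow> 'a \<Rightarrow> 'a \<Rightarrow> 'a"
    and d :: "nat \<Rightarrow> 'a \<Rightarrow> 'a"
  assumes forms_module: "module K (\<Omega> n)"
    and forms_zero: "\<Omega> 0 = A"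
    and wedge_bilinear: "bilinear K (\<Omega> m) (\<Omega> n) (\<Omega> (m + n)) (w m n)"
    and wedge_zero: "\<lbrakk>a \<in> carrier A; b \<in> carrier A\<rbrakk> \<Longrightarrow> w 0 0 a b = a \<otimes>\<^bsub>A\<^esub> b"
    and wedge_one_left: "x \<in> carrier (\<Omega> n) \<Longrightarrow> w 0 n \<one>\<^bsub>A\<^esub> x = x"
    and wedge_one_right: "x \<in> carrier (\<Omega> n) \<Longrightarrow> w n 0 x \<one>\<^bsub>A\<^esub> = x"
    and wedge_assoc:
      "\<lbrakk>x \<in> carrier (\<Omega> l); y \<in> carrier (\<Omega> m); z \<in> carrier (\<Omega> n)\<rbrakk> \<Longrightarrow>
       w (l + m) n (w l m x y) z = w l (m + n) x (w m n y z)"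
    and d_hom: "d n \<in> module_hom K (\<Omega> n) (\<Omega> (Suc n))"
    and d_d: "x \<in> carrier (\<Omega> n) \<Longrightarrow> d (Suc n) (d n x) = \<zero>\<^bsub>\<Omega> (Suc (Suc n))\<^esub>"
    and leibniz:
      "\<lbrakk>x \<in> carrier (\<Omega> m); y \<in> carrier (\<Omega> n)\<rbrakk> \<Longrightarrow>
       d (m + n) (w m n x y) =
       w (Suc m) n (d m x) y \<oplus>\<^bsub>\<Omega> (Suc (m + n))\<^esub>
         signed (\<Omega> (Suc (m + n))) m (w m (Suc n) x (d n y))"
    and one_forms:
      "\<omega> \<in> carrier (\<Omega> 1) \<Longrightarrow>
       \<exists>(N::nat) a b. (\<forall>i<N. a i \<in> carrier A \<and> b i \<in> carrier A) \<and>
         \<omega> = (\<Oplus>\<^bsub>\<Omega> 1\<^esub>i\<in>{..<N}. w 0 1 (a i) (d 0 (b i)))"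

definition connected_calculus ::
    "'k ring \<Rightarrow> ('k, 'a) module \<Rightarrow> (nat \<Rightarrow> ('k, 'a) module) \<Rightarrow> (nat \<Rightarrow> 'a \<Rightarrow> 'a) \<Rightarrow> bool" where
  "connected_calculus K P \<Omega> d \<longleftrightarrow>
     {p \<in> carrier P. d 0 p = \<zero>\<^bsub>\<Omega> 1\<^esub>} = {c \<odot>\<^bsub>P\<^esub> \<one>\<^bsub>P\<^esub> | c. c \<in> carrier K}"

text \<open>An element of degree \<open>n\<close> of the tensor product calculus is the family of its components
  in \<open>\<Omega> r \<otimes> \<Omega> (n - r)\<close>, \<open>r \<le> n\<close>. The component in \<open>\<Omega> r \<otimes> \<Omega> (n + 1 - r)\<close> of its differential
  receives contributions from the components \<open>r - 1\<close> and \<open>r\<close>.\<close>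

definition tensor_forms ::
    "'k ring \<Rightarrow> (nat \<Rightarrow> ('k, 'a) module) \<Rightarrow> nat \<Rightarrow> ('k, nat \<Rightarrow> ('k, 'a, 'a) tensor) module" where
  "tensor_forms K \<Omega> n = direct_sum {..n} (\<lambda>r. tensor K (\<Omega> r) (\<Omega> (n - r)))"

definition tensor_d ::
    "'k ring \<Rightarrow> (nat \<Rightarrow> ('k, 'a) module) \<Rightarrow> (nat \<Rightarrow> 'a \<Rightarrow> 'a) \<Rightarrow> nat \<Rightarrow>
     (nat \<Rightarrow> ('k, 'a, 'a) tensor) \<Rightarrow> nat \<Rightarrow> ('k, 'a, 'a) tensor" where
  "tensor_d K \<Omega> d n x = (\<lambda>r\<in>{..Suc n}. let T = tensor K (\<Omega> r) (\<Omega> (Suc n - r)) in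
     (case r of 0 \<Rightarrow> \<zero>\<^bsub>T\<^esub>
      | Suc q \<Rightarrow> tensor_map K (\<Omega> q) (\<Omega> (n - q)) (\<Omega> r) (\<Omega> (n - q)) (d q) id (x q))
     \<oplus>\<^bsub>T\<^esub>
     (if r = Suc n then \<zero>\<^bsub>T\<^esub>
      else signed T r
             (tensor_map K (\<Omega> r) (\<Omega> (n - r)) (\<Omega> r) (\<Omega> (Suc n - r)) id (d (n - r)) (x r))))"

text \<open>\<open>\<Delta>(p) (id \<otimes> d) \<Delta>(q) = p\<^sub>(\<^sub>1\<^sub>) q\<^sub>(\<^sub>1\<^sub>) \<otimes> p\<^sub>(\<^sub>2\<^sub>) d q\<^sub>(\<^sub>2\<^sub>)\<close> and its mirror image.\<close>

definition left_form ::
    "'k ring \<Rightarrow> ('k, 'a) module \<Rightarrow> ('a \<Rightarrow> ('k, 'a, 'a) tensor) \<Rightarrow> (nat \<Rightarrow> ('k, 'a) module) \<Rightarrow>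
     (nat \<Rightarrow> nat \<Rightarrow> 'a \<Rightarrow> 'a \<Rightarrow> 'a) \<Rightarrow> (nat \<Rightarrow> 'a \<Rightarrow> 'a) \<Rightarrow> 'a \<Rightarrow> 'a \<Rightarrow> ('k, 'a, 'a) tensor" where
  "left_form K P \<Delta> \<Omega> w d p q =
     tensor_mult K P P P (\<Omega> 1) P (\<Omega> 1) (mult P) (w 0 1)
       (\<Delta> p) (tensor_map K P P P (\<Omega> 1) id (d 0) (\<Delta> q))"

definition right_form ::
    "'k ring \<Rightarrow> ('k, 'a) module \<Rightarrow> ('a \<Rightarrow> ('k, 'a, 'a) tensor) \<Rightarrow> (nat \<Rightarrow> ('k, 'a) module) \<Rightarrow>
     (nat \<Rightarrow> nat \<Rightarrow> 'a \<Rightarrow> 'a \<Rightarrow> 'a) \<Rightarrow> (nat \<Rightarrow> 'a \<Rightarrow> 'a) \<Rightarrow> 'a \<Rightarrow> 'a \<Rightarrow> ('k, 'a, 'a) tensor" where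
  "right_form K P \<Delta> \<Omega> w d p q =
     tensor_mult K P P (\<Omega> 1) P (\<Omega> 1) P (w 0 1) (mult P)
       (\<Delta> p) (tensor_map K P P (\<Omega> 1) P (d 0) id (\<Delta> q))"

text \<open>The coaction \<open>\<Pi>\<^sub>0 \<circ> \<Delta>s\<close> on forms; \<open>\<Pi>\<^sub>0\<close> takes the component with index \<open>0\<close>.\<close>

definition form_coaction ::
    "(nat \<Rightarrow> 'a \<Rightarrow> nat \<Rightarrow> ('k, 'a, 'a) tensor) \<Rightarrow> nat \<Rightarrow> 'a \<Rightarrow> ('k, 'a, 'a) tensor" where
  "form_coaction \<Delta>s n \<omega> = \<Delta>s n \<omega> 0"

text \<open>A bicovariant calculus on a Hopf algebra. The first two axioms are Woronowicz's: left and
  right covariance of \<open>\<Omega> 1\<close>. The remaining ones say that the coproduct is differentiable, with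
  extension \<open>\<Delta>s n : \<Omega> n \<rightarrow> \<Omega>\<^sup>n(P \<otimes> P)\<close> commuting with the differentials, and that
  its \<open>P \<otimes> \<Omega> n\<close> component is a left coaction given by the usual formula on one-forms.
  Forms of degree at least \<open>2\<close> need not be generated by \<open>P\<close> and \<open>d P\<close>, so these properties do
  not follow from covariance of \<open>\<Omega> 1\<close>. Multiplicativity of \<open>\<Delta>s\<close> is not required.\<close>

locale bicovariant_calculus = hopf_algebra K P \<Delta> \<epsilon> S + differential_calculus K P \<Omega> w d
  for K :: "'k ring" and P :: "('k, 'a) module"
    and \<Delta> :: "'a \<Rightarrow> ('k, 'a, 'a) tensor" and \<epsilon> :: "'a \<Rightarrow> 'k" and S :: "'a \<Rightarrow> 'a"
    and \<Omega> :: "nat \<Rightarrow> ('k, 'a) module"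
    and w :: "nat \<Rightarrow> nat \<Rightarrow> 'a \<Rightarrow> 'a \<Rightarrow> 'a"
    and d :: "nat \<Rightarrow> 'a \<Rightarrow> 'a" +
  fixes \<Delta>s :: "nat \<Rightarrow> 'a \<Rightarrow> nat \<Rightarrow> ('k, 'a, 'a) tensor"
  assumes left_covariant:
      "\<lbrakk>\<And>i. i < N \<Longrightarrow> a i \<in> carrier P \<and> b i \<in> carrier P;
        (\<Oplus>\<^bsub>\<Omega> 1\<^esub>i\<in>{..<N::nat}. w 0 1 (a i) (d 0 (b i))) = \<zero>\<^bsub>\<Omega> 1\<^esub>\<rbrakk> \<Longrightarrow>
       (\<Oplus>\<^bsub>tensor K P (\<Omega> 1)\<^esub>i\<in>{..<N}. left_form K P \<Delta> \<Omega> w d (a i) (b i)) =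
       \<zero>\<^bsub>tensor K P (\<Omega> 1)\<^esub>"
    and right_covariant:
      "\<lbrakk>\<And>i. i < N \<Longrightarrow> a i \<in> carrier P \<and> b i \<in> carrier P;
        (\<Oplus>\<^bsub>\<Omega> 1\<^esub>i\<in>{..<N::nat}. w 0 1 (a i) (d 0 (b i))) = \<zero>\<^bsub>\<Omega> 1\<^esub>\<rbrakk> \<Longrightarrow>
       (\<Oplus>\<^bsub>tensor K (\<Omega> 1) P\<^esub>i\<in>{..<N}. right_form K P \<Delta> \<Omega> w d (a i) (b i)) =
       \<zero>\<^bsub>tensor K (\<Omega> 1) P\<^esub>"
    and comult_forms_hom: "\<Delta>s n \<in> module_hom K (\<Omega> n) (tensor_forms K \<Omega> n)"
    and comult_forms_zero: "p \<in> carrier P \<Longrightarrow> \<Delta>s 0 p 0 = \<Delta> p"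
    and comult_forms_d:
      "\<omega> \<in> carrier (\<Omega> n) \<Longrightarrow> \<Delta>s (Suc n) (d n \<omega>) = tensor_d K \<Omega> d n (\<Delta>s n \<omega>)"
    and coaction_forms: "left_coaction K P \<Delta> \<epsilon> (\<Omega> n) (form_coaction \<Delta>s n)"
    and coaction_one_forms:
      "\<lbrakk>p \<in> carrier P; q \<in> carrier P\<rbrakk> \<Longrightarrow>
       form_coaction \<Delta>s 1 (w 0 1 p (d 0 q)) = left_form K P \<Delta> \<Omega> w d p q"

text \<open>The induced coaction \<open>[\<omega>] \<mapsto> (id \<otimes> [\<cdot>])(form_coaction \<Delta>s n \<omega>)\<close> on cohomology. Since \<open>[\<cdot>]\<close> is defined on
  cocycles only, the coaction of \<open>\<omega>\<close> is first written as the image of some \<open>y\<close> under the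
  embedding of \<open>P \<otimes> ker d\<close> into \<open>P \<otimes> \<Omega> n\<close>.\<close>

definition cohomology_coaction ::
    "'k ring \<Rightarrow> ('k, 'a) module \<Rightarrow> (nat \<Rightarrow> ('k, 'a) module) \<Rightarrow> (nat \<Rightarrow> 'a \<Rightarrow> 'a) \<Rightarrow>
     (nat \<Rightarrow> 'a \<Rightarrow> nat \<Rightarrow> ('k, 'a, 'a) tensor) \<Rightarrow> nat \<Rightarrow> 'a set \<Rightarrow> ('k, 'a, 'a set) tensor" where
  "cohomology_coaction K P \<Omega> d \<Delta>s n X =
     (let Z = cocycle_space \<Omega> d n in
      THE t. \<exists>\<omega>\<in>carrier Z. \<exists>y\<in>carrier (tensor K P Z).
        X = cohomology_class \<Omega> d n \<omega> \<and>
        tensor_map K P Z P (\<Omega> n) id id y = form_coaction \<Delta>s n \<omega> \<and>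
        t = tensor_map K P Z P (cohomology \<Omega> d n) id (cohomology_class \<Omega> d n) y)"

definition invariant_forms ::
    "'k ring \<Rightarrow> ('k, 'a) module \<Rightarrow> (nat \<Rightarrow> ('k, 'a) module) \<Rightarrow>
     (nat \<Rightarrow> 'a \<Rightarrow> nat \<Rightarrow> ('k, 'a, 'a) tensor) \<Rightarrow> nat \<Rightarrow> ('k, 'a) module" where
  "invariant_forms K P \<Omega> \<Delta>s n =
     (\<Omega> n)\<lparr>carrier := coinvariants K P (\<Omega> n) (form_coaction \<Delta>s n)\<rparr>"

definition invariant_cohomology ::
    "'k ring \<Rightarrow> ('k, 'a) module \<Rightarrow> (nat \<Rightarrow> ('k, 'a) module) \<Rightarrow> (nat \<Rightarrow> 'a \<Rightarrow> 'a) \<Rightarrow>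
     (nat \<Rightarrow> 'a \<Rightarrow> nat \<Rightarrow> ('k, 'a, 'a) tensor) \<Rightarrow> nat \<Rightarrow> ('k, 'a set) module" where
  "invariant_cohomology K P \<Omega> d \<Delta>s n =
     (cohomology \<Omega> d n)\<lparr>carrier :=
        coinvariants K P (cohomology \<Omega> d n) (cohomology_coaction K P \<Omega> d \<Delta>s n)\<rparr>"

end

theory Submission
  imports Defs
begin

text \<open>
  Averaging the coaction over the integral, \<open>\<omega> \<mapsto> \<integral>\<omega>\<^sub>(\<^sub>-\<^sub>1\<^sub>) \<omega>\<^sub>(\<^sub>0\<^sub>)\<close>, is a projection of the complex of
  forms onto the invariant forms that commutes with \<open>d\<close>. Applied to a primitive of an invariant
  form it gives an invariant primitive, and applied to a cocycle with invariant class it gives an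
  invariant cocycle in the same class.

  Over a field the class map on cocycles extends to a linear map \<open>q\<close> on all forms, so the coaction
  on cohomology is \<open>[\<omega>] \<mapsto> (id \<otimes> q)(\<Pi>\<^sub>0 (\<Delta>s \<omega>))\<close>. As \<open>\<Delta>s \<omega>\<close> is closed for closed \<open>\<omega>\<close>, this element is
  killed by \<open>d \<otimes> id\<close>. For connected \<open>P\<close> it is therefore \<open>1 \<otimes> h\<close> for some class \<open>h\<close>, and the counit
  identifies \<open>h\<close> with \<open>[\<omega>]\<close>.
\<close>

section \<open>Vector spaces\<close>

lemma (in abelian_group) minus_add_cancel:
  "\<lbrakk>x \<in> carrier G; y \<in> carrier G\<rbrakk> \<Longrightarrow> (x \<ominus> y) \<oplus> y = x"
  by (simp add: a_minus_def a_assoc l_neg)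

lemma (in abelian_group) minus_eq_zero_iff:
  assumes "x \<in> carrier G" "y \<in> carrier G"
  shows "x \<ominus> y = \<zero> \<longleftrightarrow> x = y"
proof
  assume "x \<ominus> y = \<zero>"
  then show "x = y" using minus_add_cancel[OF assms] assms(2) by simp
qed (use assms in \<open>simp add: a_minus_def r_neg\<close>)

lemma module_hom_id: "id \<in> module_hom K M M"
  by (simp add: module_hom_def)

lemma module_hom_comp:
  "\<lbrakk>f \<in> module_hom K M N; g \<in> module_hom K N W\<rbrakk> \<Longrightarrow> (\<lambda>x. g (f x)) \<in> module_hom K M W"
  by (auto simp: module_hom_def Pi_iff)

lemma module_hom_add:
  assumes "module K W" "f \<in> module_hom K M W" "g \<in> module_hom K M W"
  shows "(\<lambda>x. f x \<oplus>\<^bsub>W\<^esub> g x) \<in> module_hom K M W"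
proof -
  interpret W: module K W by fact
  show ?thesis
    by (rule module_homI)
      (simp_all add: module_homD[OF assms(2)] module_homD[OF assms(3)] W.smult_r_distr
        W.a_assoc W.a_lcomm)
qed

lemma module_hom_smult:
  assumes "module K W" "f \<in> module_hom K M W" "c \<in> carrier K"
  shows "(\<lambda>x. c \<odot>\<^bsub>W\<^esub> f x) \<in> module_hom K M W"
proof -
  interpret W: module K W by fact
  show ?thesis
    by (rule module_homI)
      (use assms(3) in \<open>simp_all add: module_homD[OF assms(2)] W.smult_r_distr
        W.smult_assoc1[symmetric] W.R.m_comm\<close>)
qed

lemma module_hom_minus:
  assumes "module K W" "f \<in> module_hom K M W" "g \<in> module_hom K M W"
  shows "(\<lambda>x. f x \<ominus>\<^bsub>W\<^esub> g x) \<in> module_hom K M W"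
proof -
  interpret W: module K W by fact
  show ?thesis
    by (rule module_homI)
      (simp_all add: module_homD[OF assms(2)] module_homD[OF assms(3)] a_minus_def W.smult_r_distr
        W.smult_r_minus W.minus_add W.a_ac)
qed

lemma module_hom_image:
  assumes "module K M" "module K W" "f \<in> module_hom K M W"
  shows "submodule (f ` carrier M) K W"
proof -
  interpret M: module K M by fact
  interpret W: module K W by fact
  note fD = module_homD[OF assms(3)] module_hom_zero[OF assms] module_hom_neg[OF assms]
  show ?thesis
  proof (rule W.submoduleI)
    show "\<zero>\<^bsub>W\<^esub> \<in> f ` carrier M"
      by (rule image_eqI[of _ _ "\<zero>\<^bsub>M\<^esub>"]) (simp_all add: fD)
  qed (auto simp: fD(1) fD(2,3,5)[symmetric])
qed

section \<open>Complements of subspaces and generalised inverses of linear maps\<close>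

text \<open>Zorn's lemma gives a submodule \<open>C\<close> maximal among those meeting
  \<open>N\<close> only in zero. A vector outside \<open>N + C\<close> could be adjoined to
  \<open>C\<close> without creating an intersection with \<open>N\<close>, because nonzero scalars
  are invertible; this contradicts maximality.\<close>

lemma submodule_complement:
  assumes "field K" "module K M" "submodule N K M"
  obtains C where "submodule C K M" "N \<inter> C = {\<zero>\<^bsub>M\<^esub>}"
    "\<forall>x\<in>carrier M. \<exists>n\<in>N. \<exists>c\<in>C. x = n \<oplus>\<^bsub>M\<^esub> c"
proof -
  interpret K: field K by fact
  interpret M: module K M by fact
  interpret N: submodule N K M by fact
  note subD = M.submoduleE
  have zero: "\<zero>\<^bsub>M\<^esub> \<in> C" if "submodule C K M" for C
    using submodule.axioms(1)[OF that] by (auto dest: subgroup.one_closed)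
  define \<A> where "\<A> = {C. submodule C K M \<and> N \<inter> C = {\<zero>\<^bsub>M\<^esub>}}"
  have "\<exists>C\<in>\<A>. \<forall>X\<in>\<A>. C \<subseteq> X \<longrightarrow> X = C"
  proof (rule subset_Zorn_nonempty)
    have "submodule {\<zero>\<^bsub>M\<^esub>} K M" by (rule M.submoduleI) auto
    then show "\<A> \<noteq> {}" using zero[OF assms(3)] by (auto simp: \<A>_def)
    fix \<C> assume ne: "\<C> \<noteq> {}" and ch: "subset.chain \<A> \<C>"
    have sub: "submodule C K M" "N \<inter> C = {\<zero>\<^bsub>M\<^esub>}" if "C \<in> \<C>" for C
      using ch that by (auto simp: subset_chain_def \<A>_def)
    have dir: "C \<subseteq> D \<or> D \<subseteq> C" if "C \<in> \<C>" "D \<in> \<C>" for C D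
      using ch that by (auto simp: subset_chain_def)
    have "submodule (\<Union>\<C>) K M"
    proof (rule M.submoduleI)
      show "\<Union>\<C> \<subseteq> carrier M" using subD(1)[OF sub(1)] by blast
      show "\<zero>\<^bsub>M\<^esub> \<in> \<Union>\<C>" using ne zero[OF sub(1)] by blast
      show "\<ominus>\<^bsub>M\<^esub> a \<in> \<Union>\<C>" if "a \<in> \<Union>\<C>" for a
        using that subD(3)[OF sub(1)] by blast
      show "c \<odot>\<^bsub>M\<^esub> a \<in> \<Union>\<C>" if "c \<in> carrier K" "a \<in> \<Union>\<C>" for c a
        using that subD(4)[OF sub(1)] by blast
      fix a b assume "a \<in> \<Union>\<C>" "b \<in> \<Union>\<C>"
      then obtain C where "C \<in> \<C>" "a \<in> C" "b \<in> C" using dir by blast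
      then show "a \<oplus>\<^bsub>M\<^esub> b \<in> \<Union>\<C>" using subD(5)[OF sub(1)] by blast
    qed
    moreover have "N \<inter> \<Union>\<C> = {\<zero>\<^bsub>M\<^esub>}" using ne sub(2) by blast
    ultimately show "\<Union>\<C> \<in> \<A>" by (simp add: \<A>_def)
  qed
  then obtain C where C: "submodule C K M" "N \<inter> C = {\<zero>\<^bsub>M\<^esub>}"
    and max: "\<And>X. \<lbrakk>submodule X K M; N \<inter> X = {\<zero>\<^bsub>M\<^esub>}; C \<subseteq> X\<rbrakk> \<Longrightarrow> X = C"
    by (auto simp: \<A>_def)
  note Cc = subsetD[OF subD(1)[OF C(1)]] and Nc = subsetD[OF subD(1)[OF assms(3)]]
  have "\<exists>n\<in>N. \<exists>c\<in>C. v = n \<oplus>\<^bsub>M\<^esub> c" if v: "v \<in> carrier M" for v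
  proof (rule ccontr)
    assume neg: "\<not> ?thesis"
    \<comment> \<open>\<open>X\<close> is \<open>C\<close> enlarged by the line through the missing
      vector \<open>v\<close>.\<close>
    define X where "X = {c \<oplus>\<^bsub>M\<^esub> a \<odot>\<^bsub>M\<^esub> v | c a. c \<in> C \<and> a \<in> carrier K}"
    have XI: "x \<in> X" if "x = c \<oplus>\<^bsub>M\<^esub> a \<odot>\<^bsub>M\<^esub> v" "c \<in> C" "a \<in> carrier K" for x c a
      using that by (auto simp: X_def)
    have "submodule X K M"
    proof (rule M.submoduleI)
      show "X \<subseteq> carrier M" using Cc v by (auto simp: X_def)
      show "\<zero>\<^bsub>M\<^esub> \<in> X"
        by (rule XI[of _ "\<zero>\<^bsub>M\<^esub>" "\<zero>\<^bsub>K\<^esub>"]) (use zero[OF C(1)] v in auto)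
    next
      fix x assume "x \<in> X"
      then obtain c a where x: "x = c \<oplus>\<^bsub>M\<^esub> a \<odot>\<^bsub>M\<^esub> v" "c \<in> C" "a \<in> carrier K"
        by (auto simp: X_def)
      show "\<ominus>\<^bsub>M\<^esub> x \<in> X"
        by (rule XI[of _ "\<ominus>\<^bsub>M\<^esub> c" "\<ominus>\<^bsub>K\<^esub> a"])
          (use x v Cc subD(3)[OF C(1)] in \<open>auto simp: M.minus_add M.smult_l_minus\<close>)
      show "b \<odot>\<^bsub>M\<^esub> x \<in> X" if "b \<in> carrier K" for b
        by (rule XI[of _ "b \<odot>\<^bsub>M\<^esub> c" "b \<otimes>\<^bsub>K\<^esub> a"])
          (use x v that Cc subD(4)[OF C(1)] in \<open>auto simp: M.smult_r_distr M.smult_assoc1\<close>)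
      fix y assume "y \<in> X"
      then obtain c' a' where y: "y = c' \<oplus>\<^bsub>M\<^esub> a' \<odot>\<^bsub>M\<^esub> v" "c' \<in> C" "a' \<in> carrier K"
        by (auto simp: X_def)
      show "x \<oplus>\<^bsub>M\<^esub> y \<in> X"
        by (rule XI[of _ "c \<oplus>\<^bsub>M\<^esub> c'" "a \<oplus>\<^bsub>K\<^esub> a'"])
          (use x y v Cc subD(5)[OF C(1)] in \<open>auto simp: M.smult_l_distr M.a_assoc M.a_lcomm\<close>)
    qed
    moreover have "N \<inter> X = {\<zero>\<^bsub>M\<^esub>}"
    proof -
      have "x = \<zero>\<^bsub>M\<^esub>" if xN: "x \<in> N" and xX: "x \<in> X" for x
      proof -
        obtain c a where x: "x = c \<oplus>\<^bsub>M\<^esub> a \<odot>\<^bsub>M\<^esub> v" "c \<in> C" "a \<in> carrier K"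
          using xX by (auto simp: X_def)
        show ?thesis
        proof (cases "a = \<zero>\<^bsub>K\<^esub>")
          case True
          then have "x = c" using x v Cc by simp
          then show ?thesis using C(2) xN x(2) by blast
        next
          case False
          \<comment> \<open>A nonzero coefficient of \<open>v\<close> can be divided out, which
            would express \<open>v\<close> as an element of \<open>N + C\<close>.\<close>
          define b where "b = inv\<^bsub>K\<^esub> a"
          have b: "b \<in> carrier K" "b \<otimes>\<^bsub>K\<^esub> a = \<one>\<^bsub>K\<^esub>"
            using False x(3) K.field_Units by (auto simp: b_def)
          have "b \<odot>\<^bsub>M\<^esub> x = b \<odot>\<^bsub>M\<^esub> c \<oplus>\<^bsub>M\<^esub> v"
            using x b v Cc by (simp add: M.smult_r_distr M.smult_assoc1[symmetric])
          then have "v = b \<odot>\<^bsub>M\<^esub> x \<oplus>\<^bsub>M\<^esub> \<ominus>\<^bsub>M\<^esub> (b \<odot>\<^bsub>M\<^esub> c)"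
            using b v Cc[OF x(2)] by (simp add: M.a_ac M.r_neg M.r_neg1 M.r_neg2)
          moreover have "b \<odot>\<^bsub>M\<^esub> x \<in> N" "\<ominus>\<^bsub>M\<^esub> (b \<odot>\<^bsub>M\<^esub> c) \<in> C"
            using subD(4)[OF assms(3) b(1) xN] subD(3)[OF C(1)] subD(4)[OF C(1) b(1) x(2)] by auto
          ultimately show ?thesis using neg by blast
        qed
      qed
      moreover have "\<zero>\<^bsub>M\<^esub> \<in> X" using zero[OF \<open>submodule X K M\<close>] .
      ultimately show ?thesis using zero[OF assms(3)] by blast
    qed
    moreover have "C \<subseteq> X"
    proof
      fix c assume "c \<in> C"
      then show "c \<in> X" by (intro XI[of _ c "\<zero>\<^bsub>K\<^esub>"]) (use v Cc in auto)
    qed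
    ultimately have "X = C" by (rule max)
    moreover have "v \<in> X"
      by (rule XI[of _ "\<zero>\<^bsub>M\<^esub>" "\<one>\<^bsub>K\<^esub>"]) (use zero[OF C(1)] v in auto)
    ultimately have "v \<in> C" by simp
    moreover have "v = \<zero>\<^bsub>M\<^esub> \<oplus>\<^bsub>M\<^esub> v" using v by simp
    ultimately show False using neg zero[OF assms(3)] by blast
  qed
  with that[OF C] show ?thesis by blast
qed

text \<open>Project \<open>W\<close> onto the image of \<open>f\<close> along a complement
  \<open>D\<close>, then invert \<open>f\<close> on a complement \<open>C\<close> of its kernel. The
  point is that \<open>x - s (f x)\<close> is then a linear projection onto the kernel of
  \<open>f\<close>; being given by linear maps, it survives tensoring.\<close>

lemma generalised_inverse:
  assumes "field K" "module K M" "module K W" "f \<in> module_hom K M W"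
  obtains s where "s \<in> module_hom K W M" "\<And>x. x \<in> carrier M \<Longrightarrow> f (s (f x)) = f x"
proof -
  interpret M: module K M by fact
  interpret W: module K W by fact
  note fD = module_homD[OF assms(4)] module_hom_zero[OF assms(2-4)] module_hom_neg[OF assms(2-4)]
  let ?N = "{x \<in> carrier M. f x = \<zero>\<^bsub>W\<^esub>}"
  obtain C where C: "submodule C K M" "?N \<inter> C = {\<zero>\<^bsub>M\<^esub>}"
    "\<forall>x\<in>carrier M. \<exists>n\<in>?N. \<exists>c\<in>C. x = n \<oplus>\<^bsub>M\<^esub> c"
    using submodule_complement[OF assms(1,2) module_hom_kernel[OF assms(2-4)]] by blast
  obtain D where D: "submodule D K W" "f ` carrier M \<inter> D = {\<zero>\<^bsub>W\<^esub>}"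
    "\<forall>y\<in>carrier W. \<exists>n\<in>f ` carrier M. \<exists>c\<in>D. y = n \<oplus>\<^bsub>W\<^esub> c"
    using submodule_complement[OF assms(1,3) module_hom_image[OF assms(2-4)]] by blast
  note CE = M.submoduleE[OF C(1)] and DE = W.submoduleE[OF D(1)]
  have zeroD: "\<zero>\<^bsub>W\<^esub> \<in> D" using D(2) by blast
  \<comment> \<open>\<open>R y c\<close> says that \<open>f c\<close> is the component of
    \<open>y\<close> in the image of \<open>f\<close>, with \<open>c\<close> normalised to lie in
    \<open>C\<close>. Once \<open>R\<close> is known to be functional, linearity of \<open>s\<close>
    only requires exhibiting decompositions.\<close>
  define R where "R y c \<longleftrightarrow> c \<in> C \<and> (\<exists>z\<in>D. y = f c \<oplus>\<^bsub>W\<^esub> z)" for y c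
  have ex: "\<exists>c. R y c" if y: "y \<in> carrier W" for y
  proof -
    obtain x z where x: "x \<in> carrier M" "z \<in> D" "y = f x \<oplus>\<^bsub>W\<^esub> z" using D(3) y by blast
    obtain n c where n: "n \<in> ?N" "c \<in> C" "x = n \<oplus>\<^bsub>M\<^esub> c" using C(3) x(1) by blast
    then have "f x = f c" using CE(1) by (auto simp: fD)
    then show ?thesis using x n by (auto simp: R_def)
  qed
  have uniq: "c = c'" if "R y c" "R y c'" for y c c'
  proof -
    obtain z z' where c: "c \<in> C" "c' \<in> C" and z: "z \<in> D" "z' \<in> D"
      and y: "y = f c \<oplus>\<^bsub>W\<^esub> z" "y = f c' \<oplus>\<^bsub>W\<^esub> z'"
      using \<open>R y c\<close> \<open>R y c'\<close> unfolding R_def by blast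
    note eq = y(1)[symmetric, unfolded y(2)]
    have cM: "c \<in> carrier M" "c' \<in> carrier M" "z \<in> carrier W" "z' \<in> carrier W"
      using c z CE(1) DE(1) by auto
    \<comment> \<open>The difference of two decompositions of \<open>y\<close> lies both in the
      image of \<open>f\<close> and in \<open>D\<close>, so it vanishes; then \<open>c - c'\<close>
      lies both in the kernel and in \<open>C\<close>.\<close>
    have "f (c \<ominus>\<^bsub>M\<^esub> c') = z' \<ominus>\<^bsub>W\<^esub> z"
    proof -
      have "f (c \<ominus>\<^bsub>M\<^esub> c') = f c \<ominus>\<^bsub>W\<^esub> f c'" using cM by (simp add: a_minus_def fD)
      also have "\<dots> = (f c \<oplus>\<^bsub>W\<^esub> z) \<oplus>\<^bsub>W\<^esub> (\<ominus>\<^bsub>W\<^esub> z \<oplus>\<^bsub>W\<^esub> \<ominus>\<^bsub>W\<^esub> f c')"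
        using cM by (simp add: a_minus_def fD W.a_assoc W.r_neg2)
      also have "\<dots> = (z' \<oplus>\<^bsub>W\<^esub> f c') \<oplus>\<^bsub>W\<^esub> (\<ominus>\<^bsub>W\<^esub> f c' \<oplus>\<^bsub>W\<^esub> \<ominus>\<^bsub>W\<^esub> z)"
        unfolding eq using cM by (simp add: fD W.a_comm)
      also have "\<dots> = z' \<ominus>\<^bsub>W\<^esub> z"
        using cM by (simp add: a_minus_def fD W.a_assoc W.r_neg2)
      finally show ?thesis .
    qed
    moreover have "z' \<ominus>\<^bsub>W\<^esub> z \<in> D" using z DE by (simp add: a_minus_def)
    moreover have "f (c \<ominus>\<^bsub>M\<^esub> c') \<in> f ` carrier M" using cM by simp
    ultimately have "f (c \<ominus>\<^bsub>M\<^esub> c') = \<zero>\<^bsub>W\<^esub>" using D(2) by auto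
    moreover have "c \<ominus>\<^bsub>M\<^esub> c' \<in> C" using c CE by (simp add: a_minus_def)
    ultimately have "c \<ominus>\<^bsub>M\<^esub> c' = \<zero>\<^bsub>M\<^esub>" using C(2) cM by blast
    then show ?thesis using cM by (simp add: M.minus_eq_zero_iff)
  qed
  define s where "s y = (THE c. R y c)" for y
  have sI: "s y = c" if "R y c" for y c
    unfolding s_def using that uniq by (intro the_equality) auto
  have sR: "R y (s y)" if "y \<in> carrier W" for y
    using ex[OF that] sI by metis
  show ?thesis
  proof (rule that)
    show "s \<in> module_hom K W M"
    proof (rule module_homI)
      fix y assume y: "y \<in> carrier W"
      show "s y \<in> carrier M" using sR[OF y] CE(1) by (auto simp: R_def)
      obtain z where z: "s y \<in> C" "z \<in> D" "y = f (s y) \<oplus>\<^bsub>W\<^esub> z"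
        using sR[OF y] unfolding R_def by blast
      have cl: "s y \<in> carrier M" "z \<in> carrier W" using z CE(1) DE(1) by auto
      show "s (c \<odot>\<^bsub>W\<^esub> y) = c \<odot>\<^bsub>M\<^esub> s y" if c: "c \<in> carrier K" for c
      proof (rule sI)
        have "c \<odot>\<^bsub>W\<^esub> y = f (c \<odot>\<^bsub>M\<^esub> s y) \<oplus>\<^bsub>W\<^esub> c \<odot>\<^bsub>W\<^esub> z"
          by (subst z(3)) (use c cl in \<open>simp add: fD W.smult_r_distr\<close>)
        then show "R (c \<odot>\<^bsub>W\<^esub> y) (c \<odot>\<^bsub>M\<^esub> s y)"
          unfolding R_def using z(1,2) c CE(4) DE(4) by blast
      qed
      fix y' assume y': "y' \<in> carrier W"
      obtain z' where z': "s y' \<in> C" "z' \<in> D" "y' = f (s y') \<oplus>\<^bsub>W\<^esub> z'"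
        using sR[OF y'] unfolding R_def by blast
      have cl': "s y' \<in> carrier M" "z' \<in> carrier W" using z' CE(1) DE(1) by auto
      show "s (y \<oplus>\<^bsub>W\<^esub> y') = s y \<oplus>\<^bsub>M\<^esub> s y'"
      proof (rule sI)
        have "y \<oplus>\<^bsub>W\<^esub> y' = f (s y \<oplus>\<^bsub>M\<^esub> s y') \<oplus>\<^bsub>W\<^esub> (z \<oplus>\<^bsub>W\<^esub> z')"
          by (subst z(3), subst z'(3)) (use cl cl' in \<open>simp add: fD W.a_ac\<close>)
        then show "R (y \<oplus>\<^bsub>W\<^esub> y') (s y \<oplus>\<^bsub>M\<^esub> s y')"
          unfolding R_def using z(1,2) z'(1,2) CE(5) DE(5) by blast
      qed
    qed
    fix x assume x: "x \<in> carrier M"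
    then obtain n c where n: "n \<in> ?N" "c \<in> C" "x = n \<oplus>\<^bsub>M\<^esub> c" using C(3) by blast
    have fc: "f x = f c" "c \<in> carrier M" using n CE(1) by (auto simp: fD)
    then have "f x = f c \<oplus>\<^bsub>W\<^esub> \<zero>\<^bsub>W\<^esub>" by (simp add: fD)
    then have "s (f x) = c" using n zeroD by (intro sI) (auto simp: R_def)
    then show "f (s (f x)) = f x" using fc by simp
  qed
qed

section \<open>Maps between tensor products\<close>

lemma tensor_module: "\<lbrakk>module K A; module K B\<rbrakk> \<Longrightarrow> module K (tensor K A B)"
  by (rule tensor_facts)

lemma pure_hom:
  assumes "module K A" "module K B"
  shows "a \<in> carrier A \<Longrightarrow> pure K A B a \<in> module_hom K B (tensor K A B)"
    and "b \<in> carrier B \<Longrightarrow> (\<lambda>a. pure K A B a b) \<in> module_hom K A (tensor K A B)"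
  using pure_bilinear[OF assms] by (auto simp: bilinear_def)

lemma pure_closed:
  assumes "module K A" "module K B"
  shows "\<lbrakk>a \<in> carrier A; b \<in> carrier B\<rbrakk> \<Longrightarrow> pure K A B a b \<in> carrier (tensor K A B)"
  using module_homD(1)[OF pure_hom(1)[OF assms]] by blast

text \<open>Every tensor is a finite sum of pure ones. This is the principle by which the later
  identities between maps on tensor products are reduced to pure tensors.\<close>

lemma tensor_hom_eqI:
  assumes "module K A" "module K B" "module K W"
    and f: "f \<in> module_hom K (tensor K A B) W" and g: "g \<in> module_hom K (tensor K A B) W"
    and eq: "\<And>a b. \<lbrakk>a \<in> carrier A; b \<in> carrier B\<rbrakk> \<Longrightarrow> f (pure K A B a b) = g (pure K A B a b)"
    and "t \<in> carrier (tensor K A B)"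
  shows "f t = g t"
  using assms(1,2,7)
proof (induction t rule: tensor_induct)
  case zero
  then show ?case using module_hom_zero[OF tensor_module[OF assms(1,2)] assms(3)] f g by metis
next
  case (step t a b)
  then show ?case
    by (simp add: module_homD(2)[OF f] module_homD(2)[OF g] pure_closed[OF assms(1,2)] eq)
qed

lemma tensor_map:
  assumes "module K A" "module K B" "module K C" "module K E"
    and f: "f \<in> module_hom K A C" and g: "g \<in> module_hom K B E"
  shows "tensor_map K A B C E f g \<in> module_hom K (tensor K A B) (tensor K C E)"
    and "\<lbrakk>a \<in> carrier A; b \<in> carrier B\<rbrakk> \<Longrightarrow>
      tensor_map K A B C E f g (pure K A B a b) = pure K C E (f a) (g b)"
proof -
  have "bilinear K A B (tensor K C E) (\<lambda>a b. pure K C E (f a) (g b))"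
    unfolding bilinear_def
    using module_hom_comp[OF f pure_hom(2)[OF assms(3,4)]]
      module_hom_comp[OF g pure_hom(1)[OF assms(3,4)]] module_homD(1)[OF f] module_homD(1)[OF g]
    by auto
  note L = tensor_lift[OF assms(1,2) tensor_module[OF assms(3,4)] this, folded tensor_map_def]
  show "tensor_map K A B C E f g \<in> module_hom K (tensor K A B) (tensor K C E)" by (rule L)
  show "tensor_map K A B C E f g (pure K A B a b) = pure K C E (f a) (g b)"
    if "a \<in> carrier A" "b \<in> carrier B" using that by (rule L)
qed

text \<open>Functoriality of the tensor product. The composites enter as separate maps
  \<open>f''\<close> and \<open>g''\<close> that need to agree only on the carriers, so that, for
  example, \<open>id\<close> can stand for a composite of identities.\<close>

lemma tensor_map_eqI:
  assumes "module K A" "module K B" "module K C" "module K E" "module K A'" "module K B'"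
    and "f \<in> module_hom K A A'" "g \<in> module_hom K B B'"
    and "f' \<in> module_hom K A' C" "g' \<in> module_hom K B' E"
    and "f'' \<in> module_hom K A C" "g'' \<in> module_hom K B E"
    and "\<And>a. a \<in> carrier A \<Longrightarrow> f' (f a) = f'' a" "\<And>b. b \<in> carrier B \<Longrightarrow> g' (g b) = g'' b"
    and "t \<in> carrier (tensor K A B)"
  shows "tensor_map K A' B' C E f' g' (tensor_map K A B A' B' f g t) =
    tensor_map K A B C E f'' g'' t"
proof (rule tensor_hom_eqI[OF assms(1,2) tensor_module[OF assms(3,4)] _ _ _ assms(15)])
  note fg = tensor_map[OF assms(1,2,5-8)] and fg' = tensor_map[OF assms(5,6,3,4,9,10)]
    and fg'' = tensor_map[OF assms(1-4) assms(11,12)]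
  show "(\<lambda>t. tensor_map K A' B' C E f' g' (tensor_map K A B A' B' f g t))
      \<in> module_hom K (tensor K A B) (tensor K C E)"
    by (rule module_hom_comp[OF fg(1) fg'(1)])
  show "tensor_map K A B C E f'' g'' \<in> module_hom K (tensor K A B) (tensor K C E)" by (rule fg'')
  show "tensor_map K A' B' C E f' g' (tensor_map K A B A' B' f g (pure K A B a b)) =
      tensor_map K A B C E f'' g'' (pure K A B a b)" if "a \<in> carrier A" "b \<in> carrier B" for a b
    using that by (simp add: fg fg' fg'' assms(13,14) module_homD(1)[OF assms(7)] module_homD(1)[OF assms(8)])
qed

lemma tensor_map_zero_right:
  assumes "module K A" "module K B" "module K C" "module K E"
    and f: "f \<in> module_hom K A C" and g: "g \<in> module_hom K B E"
    and g0: "\<And>b. b \<in> carrier B \<Longrightarrow> g b = \<zero>\<^bsub>E\<^esub>" and "t \<in> carrier (tensor K A B)"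
  shows "tensor_map K A B C E f g t = \<zero>\<^bsub>tensor K C E\<^esub>"
proof -
  interpret T: module K "tensor K C E" by (rule tensor_module) fact+
  show ?thesis
  proof (rule tensor_hom_eqI[OF assms(1,2) T.module_axioms _ _ _ assms(8)])
    show "tensor_map K A B C E f g \<in> module_hom K (tensor K A B) (tensor K C E)"
      by (rule tensor_map) fact+
    show "(\<lambda>_. \<zero>\<^bsub>tensor K C E\<^esub>) \<in> module_hom K (tensor K A B) (tensor K C E)"
      by (rule module_homI) auto
    fix a b assume ab: "a \<in> carrier A" "b \<in> carrier B"
    have "pure K C E (f a) \<zero>\<^bsub>E\<^esub> = \<zero>\<^bsub>tensor K C E\<^esub>"
      by (rule module_hom_zero[OF assms(4) T.module_axioms])
        (rule pure_hom(1)[OF assms(3,4) module_homD(1)[OF f ab(1)]])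
    then show "tensor_map K A B C E f g (pure K A B a b) = \<zero>\<^bsub>tensor K C E\<^esub>"
      by (simp add: tensor_map(2)[OF assms(1-6) ab] g0[OF ab(2)])
  qed
qed

text \<open>The third factor \<open>c\<close> is only a parameter of the inner lift. Its linearity
  in \<open>c\<close> is proved for fixed \<open>x\<close> by regarding both sides as linear maps in
  \<open>x\<close> and comparing them on pure tensors.\<close>

lemma tensor_assoc:
  assumes "module K A" "module K B" "module K C"
  shows "tensor_assoc K A B C \<in>
      module_hom K (tensor K (tensor K A B) C) (tensor K A (tensor K B C))"
    and "\<lbrakk>a \<in> carrier A; b \<in> carrier B; c \<in> carrier C\<rbrakk> \<Longrightarrow>
      tensor_assoc K A B C (pure K (tensor K A B) C (pure K A B a b) c) =
      pure K A (tensor K B C) a (pure K B C b c)"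
proof -
  let ?T = "tensor K A (tensor K B C)"
  note AB = tensor_module[OF assms(1,2)] and BC = tensor_module[OF assms(2,3)]
  note T = tensor_module[OF assms(1) BC]
  interpret T: module K ?T by (rule T)
  let ?\<beta> = "\<lambda>c a b. pure K A (tensor K B C) a (pure K B C b c)"
  note pcl = pure_closed[OF assms(2,3)] pure_closed[OF assms(1) BC]
  have bil: "bilinear K A B ?T (?\<beta> c)" if c: "c \<in> carrier C" for c
    unfolding bilinear_def
    using module_hom_comp[OF pure_hom(2)[OF assms(2,3) c] pure_hom(1)[OF assms(1) BC]]
      pure_hom(2)[OF assms(1) BC] c pcl by auto
  note L = tensor_lift[OF assms(1,2) T bil]
  let ?\<gamma> = "\<lambda>x c. tensor_lift K A B ?T (?\<beta> c) x"
  have "bilinear K (tensor K A B) C ?T ?\<gamma>"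
    unfolding bilinear_def
  proof (intro conjI ballI)
    fix x assume x: "x \<in> carrier (tensor K A B)"
    show "?\<gamma> x \<in> module_hom K C ?T"
    proof (rule module_homI)
      fix c assume c: "c \<in> carrier C"
      show "?\<gamma> x c \<in> carrier ?T" by (rule module_homD(1)[OF L(1)[OF c] x])
      interpret C: module K C by fact
      show "?\<gamma> x (c \<oplus>\<^bsub>C\<^esub> c') = ?\<gamma> x c \<oplus>\<^bsub>?T\<^esub> ?\<gamma> x c'" if c': "c' \<in> carrier C" for c'
      proof (rule tensor_hom_eqI[OF assms(1,2) T _ _ _ x])
        show "(\<lambda>x. ?\<gamma> x (c \<oplus>\<^bsub>C\<^esub> c')) \<in> module_hom K (tensor K A B) ?T"
          by (rule L) (use c c' in simp)
        show "(\<lambda>x. ?\<gamma> x c \<oplus>\<^bsub>?T\<^esub> ?\<gamma> x c') \<in> module_hom K (tensor K A B) ?T"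
          by (rule module_hom_add[OF T L(1)[OF c] L(1)[OF c']])
      qed (simp add: L(2) c c' module_homD(2)[OF pure_hom(1)[OF assms(2,3)]]
          module_homD(2)[OF pure_hom(1)[OF assms(1) BC]] pcl)
      show "?\<gamma> x (k \<odot>\<^bsub>C\<^esub> c) = k \<odot>\<^bsub>?T\<^esub> ?\<gamma> x c" if k: "k \<in> carrier K" for k
      proof (rule tensor_hom_eqI[OF assms(1,2) T _ _ _ x])
        show "(\<lambda>x. ?\<gamma> x (k \<odot>\<^bsub>C\<^esub> c)) \<in> module_hom K (tensor K A B) ?T"
          by (rule L) (use c k in simp)
        show "(\<lambda>x. k \<odot>\<^bsub>?T\<^esub> ?\<gamma> x c) \<in> module_hom K (tensor K A B) ?T"
          by (rule module_hom_smult[OF T L(1)[OF c] k])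
      qed (simp add: L(2) c k module_homD(3)[OF pure_hom(1)[OF assms(2,3)]]
          module_homD(3)[OF pure_hom(1)[OF assms(1) BC]] pcl)
    qed
  qed (rule L)
  note L' = tensor_lift[OF AB assms(3) T this]
  have eq: "tensor_assoc K A B C = tensor_lift K (tensor K A B) C ?T ?\<gamma>"
    by (simp add: tensor_assoc_def Let_def)
  show "tensor_assoc K A B C \<in> module_hom K (tensor K (tensor K A B) C) ?T"
    unfolding eq by (rule L')
  show "tensor_assoc K A B C (pure K (tensor K A B) C (pure K A B a b) c) =
      pure K A (tensor K B C) a (pure K B C b c)"
    if "a \<in> carrier A" "b \<in> carrier B" "c \<in> carrier C"
    unfolding eq using that L L' pure_closed[OF assms(1,2)] by simp
qed

section \<open>Contracting the first tensor leg with a functional\<close>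

text \<open>This is \<open>\<phi> \<otimes> id\<close> followed by the identification of
  \<open>K \<otimes> E\<close> with \<open>E\<close>. It has literally the shape of the maps in the
  counit axiom of \<open>left_coaction\<close> and in \<open>left_integral\<close>.\<close>

abbreviation slice ::
    "'k ring \<Rightarrow> ('k, 'a) module \<Rightarrow> ('a \<Rightarrow> 'k) \<Rightarrow> ('k, 'e) module \<Rightarrow> ('k, 'a, 'e) tensor \<Rightarrow> 'e" where
  "slice K P \<phi> E \<equiv> tensor_lift K P E E (\<lambda>p x. \<phi> p \<odot>\<^bsub>E\<^esub> x)"

lemma slice:
  assumes "module K P" "module K E" and \<phi>: "\<phi> \<in> module_hom K P (self_module K)"
  shows "slice K P \<phi> E \<in> module_hom K (tensor K P E) E"
    and "\<lbrakk>p \<in> carrier P; x \<in> carrier E\<rbrakk> \<Longrightarrow> slice K P \<phi> E (pure K P E p x) = \<phi> p \<odot>\<^bsub>E\<^esub> x"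
proof -
  interpret P: module K P by fact
  interpret E: module K E by fact
  have c: "\<phi> p \<in> carrier K" if "p \<in> carrier P" for p
    using module_homD(1)[OF \<phi> that] by (simp add: self_module_def)
  have "bilinear K P E E (\<lambda>p x. \<phi> p \<odot>\<^bsub>E\<^esub> x)"
    unfolding bilinear_def
    by (intro conjI ballI module_homI)
      (simp_all add: c module_homD(2,3)[OF \<phi>] self_module_def E.smult_l_distr E.smult_r_distr
        E.smult_assoc1[symmetric] P.R.m_comm)
  note L = tensor_lift[OF assms(1,2,2) this]
  show "slice K P \<phi> E \<in> module_hom K (tensor K P E) E" by (rule L)
  show "slice K P \<phi> E (pure K P E p x) = \<phi> p \<odot>\<^bsub>E\<^esub> x" if "p \<in> carrier P" "x \<in> carrier E"
    using that by (rule L)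
qed

text \<open>The contraction acts on the first leg and \<open>g\<close> on the second, so they
  commute. Taking \<open>g\<close> to be \<open>d\<close>, a coaction or a class map gives the main
  uses.\<close>

lemma slice_tensor_map:
  assumes "module K P" "module K E" "module K E'" and \<phi>: "\<phi> \<in> module_hom K P (self_module K)"
    and g: "g \<in> module_hom K E E'" and t: "t \<in> carrier (tensor K P E)"
  shows "slice K P \<phi> E' (tensor_map K P E P E' id g t) = g (slice K P \<phi> E t)"
proof (rule tensor_hom_eqI[OF assms(1,2,3) _ _ _ t])
  note m = tensor_map[OF assms(1,2,1,3) module_hom_id g]
  note S = slice[OF assms(1,2) \<phi>] and S' = slice[OF assms(1,3) \<phi>]
  show "(\<lambda>t. slice K P \<phi> E' (tensor_map K P E P E' id g t)) \<in> module_hom K (tensor K P E) E'"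
    by (rule module_hom_comp[OF m(1) S'(1)])
  show "(\<lambda>t. g (slice K P \<phi> E t)) \<in> module_hom K (tensor K P E) E'"
    by (rule module_hom_comp[OF S(1) g])
  fix p x assume "p \<in> carrier P" "x \<in> carrier E"
  then show "slice K P \<phi> E' (tensor_map K P E P E' id g (pure K P E p x)) =
      g (slice K P \<phi> E (pure K P E p x))"
    using module_homD(1)[OF \<phi>, of p]
    by (simp add: m S S' module_homD(1)[OF g] module_homD(3)[OF g] self_module_def)
qed

text \<open>Tensoring with \<open>P\<close> is exact over a field: the kernel of
  \<open>id \<otimes> f\<close> is the image of \<open>P \<otimes> ker f\<close>. The preimage of
  \<open>t\<close> is obtained by applying the projection onto \<open>ker f\<close> in the second
  leg.\<close>

lemma tensor_kernel:
  assumes "field K" "module K P" "module K M" "module K W"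
    and f: "f \<in> module_hom K M W"
    and t: "t \<in> carrier (tensor K P M)"
    and ker: "tensor_map K P M P W id f t = \<zero>\<^bsub>tensor K P W\<^esub>"
  defines "Z \<equiv> M\<lparr>carrier := {x \<in> carrier M. f x = \<zero>\<^bsub>W\<^esub>}\<rparr>"
  obtains y where "y \<in> carrier (tensor K P Z)" "tensor_map K P Z P M id id y = t"
proof -
  interpret M: module K M by fact
  interpret W: module K W by fact
  obtain s where s: "s \<in> module_hom K W M" "\<And>x. x \<in> carrier M \<Longrightarrow> f (s (f x)) = f x"
    using generalised_inverse[OF assms(1,3,4) f] by blast
  have Z: "module K Z"
    unfolding Z_def
    by (rule submodule.submodule_is_module[OF module_hom_kernel[OF assms(3,4) f] assms(3)])
  let ?\<pi> = "\<lambda>x. x \<ominus>\<^bsub>M\<^esub> s (f x)"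
  note fD = module_homD[OF f] and sD = module_homD[OF s(1)]
  have \<pi>: "?\<pi> \<in> module_hom K M M"
    using module_hom_minus[OF assms(3) module_hom_id module_hom_comp[OF f s(1)]] by simp
  have "f (?\<pi> x) = \<zero>\<^bsub>W\<^esub>" if "x \<in> carrier M" for x
    using that by (simp add: a_minus_def fD sD module_hom_neg[OF assms(3,4) f] s(2) W.r_neg)
  \<comment> \<open>The same function, now with the kernel as codomain.\<close>
  then have \<pi>Z: "?\<pi> \<in> module_hom K M Z"
    using \<pi> by (auto simp: module_hom_def Z_def)
  have inc: "id \<in> module_hom K Z M" by (auto simp: module_hom_def Z_def)
  note T = tensor_module[OF assms(2,3)]
  interpret T: module K "tensor K P M" by (rule T)
  note m\<pi> = tensor_map[OF assms(2,3,2,3) module_hom_id \<pi>]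
    and mf = tensor_map[OF assms(2,3,2,4) module_hom_id f]
    and ms = tensor_map[OF assms(2,4,2,3) module_hom_id s(1)]
  \<comment> \<open>The splitting of \<open>x\<close> as \<open>(x - s (f x)) + s (f x)\<close>,
    tensored with \<open>P\<close>. On \<open>t\<close> the second summand vanishes by
    \<open>ker\<close>, so the projection fixes \<open>t\<close>.\<close>
  have "tensor_map K P M P M id ?\<pi> t \<oplus>\<^bsub>tensor K P M\<^esub>
      tensor_map K P W P M id s (tensor_map K P M P W id f t) = t"
  proof (rule tensor_hom_eqI[OF assms(2,3) T _ module_hom_id[unfolded id_def] _ t])
    show "(\<lambda>t. tensor_map K P M P M id ?\<pi> t \<oplus>\<^bsub>tensor K P M\<^esub>
        tensor_map K P W P M id s (tensor_map K P M P W id f t))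
      \<in> module_hom K (tensor K P M) (tensor K P M)"
      by (rule module_hom_add[OF T m\<pi>(1) module_hom_comp[OF mf(1) ms(1)]])
    fix p x assume px: "p \<in> carrier P" "x \<in> carrier M"
    have "pure K P M p (?\<pi> x) \<oplus>\<^bsub>tensor K P M\<^esub> pure K P M p (s (f x)) =
        pure K P M p (?\<pi> x \<oplus>\<^bsub>M\<^esub> s (f x))"
      using px by (simp add: module_homD(2)[OF pure_hom(1)[OF assms(2,3)]] fD sD)
    also have "?\<pi> x \<oplus>\<^bsub>M\<^esub> s (f x) = x"
      using px by (simp add: fD sD M.minus_add_cancel)
    finally show "tensor_map K P M P M id ?\<pi> (pure K P M p x) \<oplus>\<^bsub>tensor K P M\<^esub>
        tensor_map K P W P M id s (tensor_map K P M P W id f (pure K P M p x)) = pure K P M p x"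
      using px by (simp add: m\<pi> mf ms fD)
  qed
  then have "tensor_map K P M P M id ?\<pi> t = t"
    using module_homD(1)[OF m\<pi>(1) t]
    by (simp add: ker module_hom_zero[OF tensor_module[OF assms(2,4)] T ms(1)])
  moreover have "tensor_map K P Z P M id id (tensor_map K P M P Z id ?\<pi> t) =
      tensor_map K P M P M id ?\<pi> t"
    by (rule tensor_map_eqI[OF assms(2,3,2,3,2) Z module_hom_id \<pi>Z module_hom_id inc module_hom_id \<pi> _ _ t])
      simp_all
  ultimately show ?thesis
    using that[OF module_homD(1)[OF tensor_map(1)[OF assms(2,3,2) Z module_hom_id \<pi>Z] t]] by simp
qed

section \<open>Averaging over a left integral\<close>

lemma coinvariants_submodule:
  assumes "module K P" "module K E" "\<rho> \<in> module_hom K E (tensor K P E)" "\<one>\<^bsub>P\<^esub> \<in> carrier P"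
  shows "submodule (coinvariants K P E \<rho>) K E"
proof -
  interpret E: module K E by fact
  note T = tensor_module[OF assms(1,2)] and p = pure_hom(1)[OF assms(1,2,4)]
  show ?thesis
    by (rule E.submoduleI)
      (auto simp: coinvariants_def module_homD[OF assms(3)] module_homD[OF p]
        module_hom_zero[OF assms(2) T assms(3)] module_hom_zero[OF assms(2) T p]
        module_hom_neg[OF assms(2) T assms(3)] module_hom_neg[OF assms(2) T p])
qed

text \<open>Coassociativity turns \<open>\<rho> (\<integral>e\<^sub>(\<^sub>-\<^sub>1\<^sub>) e\<^sub>(\<^sub>0\<^sub>))\<close> into the integral of the first leg of
  \<open>(\<Delta> \<otimes> id) (\<rho> e)\<close>, which by left invariance of the integral is \<open>1 \<otimes> \<integral>e\<^sub>(\<^sub>-\<^sub>1\<^sub>) e\<^sub>(\<^sub>0\<^sub>)\<close>.\<close>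

lemma integral_slice_coinvariant:
  assumes P: "module K P" and E: "module K E" and one: "\<one>\<^bsub>P\<^esub> \<in> carrier P"
    and \<Delta>: "\<Delta> \<in> module_hom K P (tensor K P P)"
    and \<rho>: "left_coaction K P \<Delta> \<epsilon> E \<rho>" and I: "left_integral K P \<Delta> I"
    and e: "e \<in> carrier E"
  shows "slice K P I E (\<rho> e) \<in> coinvariants K P E \<rho>"
proof -
  note PE = tensor_module[OF P E] and PP = tensor_module[OF P P]
  note PPE = tensor_module[OF P PE]
  have Ih: "I \<in> module_hom K P (self_module K)"
    and II: "\<And>p. p \<in> carrier P \<Longrightarrow> slice K P I P (\<Delta> p) = I p \<odot>\<^bsub>P\<^esub> \<one>\<^bsub>P\<^esub>"
    using I by (auto simp: left_integral_def)
  have \<rho>h: "\<rho> \<in> module_hom K E (tensor K P E)"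
    and coass: "tensor_assoc K P P E (tensor_map K P E (tensor K P P) E \<Delta> id (\<rho> e)) =
        tensor_map K P E P (tensor K P E) id \<rho> (\<rho> e)"
    using \<rho> e by (auto simp: left_coaction_def)
  note re = module_homD(1)[OF \<rho>h e]
  note sE = slice[OF P E Ih] and sP = slice[OF P P Ih] and sPE = slice[OF P PE Ih]
  note as = tensor_assoc[OF P P E] and m = tensor_map[OF P E PP E \<Delta> module_hom_id]
  have I_closed: "I p \<in> carrier K" if "p \<in> carrier P" for p
    using module_homD(1)[OF Ih that] by (simp add: self_module_def)
  \<comment> \<open>After reassociation the contracted leg is the first leg of \<open>u\<close>, so
    left invariance of the integral becomes applicable with \<open>u = \<Delta> p\<close>.\<close>
  have inner: "slice K P I (tensor K P E) (tensor_assoc K P P E (pure K (tensor K P P) E u x)) =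
      pure K P E (slice K P I P u) x"
    if u: "u \<in> carrier (tensor K P P)" and x: "x \<in> carrier E" for u x
  proof (rule tensor_hom_eqI[OF P P PE _ _ _ u])
    show "(\<lambda>u. slice K P I (tensor K P E) (tensor_assoc K P P E (pure K (tensor K P P) E u x)))
        \<in> module_hom K (tensor K P P) (tensor K P E)"
      by (rule module_hom_comp[OF module_hom_comp[OF pure_hom(2)[OF PP E x] as(1)] sPE(1)])
    show "(\<lambda>u. pure K P E (slice K P I P u) x) \<in> module_hom K (tensor K P P) (tensor K P E)"
      by (rule module_hom_comp[OF sP(1) pure_hom(2)[OF P E x]])
  qed (simp add: as sPE sP pure_closed[OF P E] x module_homD(3)[OF pure_hom(2)[OF P E x]] I_closed)
  have "slice K P I (tensor K P E)
        (tensor_assoc K P P E (tensor_map K P E (tensor K P P) E \<Delta> id t)) =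
      pure K P E \<one>\<^bsub>P\<^esub> (slice K P I E t)" if t: "t \<in> carrier (tensor K P E)" for t
  proof (rule tensor_hom_eqI[OF P E PE _ _ _ t])
    show "(\<lambda>t. slice K P I (tensor K P E)
        (tensor_assoc K P P E (tensor_map K P E (tensor K P P) E \<Delta> id t)))
        \<in> module_hom K (tensor K P E) (tensor K P E)"
      by (rule module_hom_comp[OF module_hom_comp[OF m(1) as(1)] sPE(1)])
    show "(\<lambda>t. pure K P E \<one>\<^bsub>P\<^esub> (slice K P I E t)) \<in> module_hom K (tensor K P E) (tensor K P E)"
      by (rule module_hom_comp[OF sE(1) pure_hom(1)[OF P E one]])
    fix p x assume px: "p \<in> carrier P" "x \<in> carrier E"
    have "slice K P I (tensor K P E)
        (tensor_assoc K P P E (tensor_map K P E (tensor K P P) E \<Delta> id (pure K P E p x))) =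
        pure K P E (I p \<odot>\<^bsub>P\<^esub> \<one>\<^bsub>P\<^esub>) x"
      unfolding m(2)[OF px] id_apply inner[OF module_homD(1)[OF \<Delta> px(1)] px(2)] II[OF px(1)] ..
    also have "\<dots> = pure K P E \<one>\<^bsub>P\<^esub> (I p \<odot>\<^bsub>E\<^esub> x)"
      using px one I_closed
      by (simp add: module_homD(3)[OF pure_hom(2)[OF P E]] module_homD(3)[OF pure_hom(1)[OF P E]])
    finally show "slice K P I (tensor K P E)
        (tensor_assoc K P P E (tensor_map K P E (tensor K P P) E \<Delta> id (pure K P E p x))) =
        pure K P E \<one>\<^bsub>P\<^esub> (slice K P I E (pure K P E p x))"
      unfolding sE(2)[OF px] .
  qed
  \<comment> \<open>Coassociativity replaces \<open>\<Delta> \<otimes> id\<close> by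
    \<open>id \<otimes> \<rho>\<close>, and naturality of the contraction then pulls
    \<open>\<rho>\<close> out.\<close>
  from this[OF re] have "\<rho> (slice K P I E (\<rho> e)) = pure K P E \<one>\<^bsub>P\<^esub> (slice K P I E (\<rho> e))"
    unfolding coass slice_tensor_map[OF P E PE Ih \<rho>h re] .
  then show ?thesis using module_homD(1)[OF sE(1) re] by (simp add: coinvariants_def)
qed

text \<open>This is where normalisation enters: the coefficient \<open>I \<one>\<close> is one. It
  makes averaging the identity on invariant forms and lets an invariant class be recovered from its
  coaction.\<close>

lemma integral_slice_one:
  assumes "module K P" "module K E" "\<one>\<^bsub>P\<^esub> \<in> carrier P"
    and "normalised_left_integral K P \<Delta> I" and "e \<in> carrier E"
  shows "slice K P I E (pure K P E \<one>\<^bsub>P\<^esub> e) = e"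
proof -
  interpret E: module K E by fact
  have "I \<in> module_hom K P (self_module K)" "I \<one>\<^bsub>P\<^esub> = \<one>\<^bsub>K\<^esub>"
    using assms(4) by (auto simp: normalised_left_integral_def left_integral_def)
  then show ?thesis using slice(2)[OF assms(1,2) _ assms(3,5)] assms(5) by simp
qed

section \<open>Cohomology of cochain complexes\<close>

text \<open>Separated from the calculus so that the same facts serve both all forms and the
  invariant forms, for which no product is set up.\<close>

locale cochain_complex =
  fixes K :: "'k ring" and C :: "nat \<Rightarrow> ('k, 'a) module" and d :: "nat \<Rightarrow> 'a \<Rightarrow> 'a"
  assumes cochains_module: "module K (C n)"
    and differential_hom: "d n \<in> module_hom K (C n) (C (Suc n))"
    and differential_square: "x \<in> carrier (C n) \<Longrightarrow> d (Suc n) (d n x) = \<zero>\<^bsub>C (Suc (Suc n))\<^esub>"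
begin

lemma cocycle_space_module: "module K (cocycle_space C d n)"
  unfolding cocycle_space_def cocycles_def
  by (rule submodule.submodule_is_module[OF module_hom_kernel])
    (rule cochains_module differential_hom)+

lemma coboundaries_submodule_cochains: "submodule (coboundaries C d n) K (C n)"
proof (cases n)
  case 0
  interpret module K "C 0" by (rule cochains_module)
  have "submodule {\<zero>\<^bsub>C 0\<^esub>} K (C 0)" by (rule submoduleI) auto
  then show ?thesis by (simp add: coboundaries_def 0)
next
  case (Suc m)
  then show ?thesis
    using module_hom_image[OF cochains_module cochains_module differential_hom]
    by (simp add: coboundaries_def)
qed

lemma coboundaries_subset: "coboundaries C d n \<subseteq> cocycles C d n"
proof -
  interpret C0: module K "C 0" by (rule cochains_module)
  show ?thesis
    using module_hom_zero[OF cochains_module cochains_module differential_hom]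
      differential_square module_homD(1)[OF differential_hom]
    by (auto simp: coboundaries_def cocycles_def split: nat.splits)
qed

lemma coboundaries_submodule: "submodule (coboundaries C d n) K (cocycle_space C d n)"
proof -
  interpret C: module K "C n" by (rule cochains_module)
  interpret Z: module K "cocycle_space C d n" by (rule cocycle_space_module)
  show ?thesis
  proof (rule Z.module_incl_imp_submodule)
    show "coboundaries C d n \<subseteq> carrier (cocycle_space C d n)"
      using coboundaries_subset by (simp add: cocycle_space_def)
    \<comment> \<open>Of two successive carrier updates only the last survives, so this is the
      submodule structure already known inside \<open>C n\<close>.\<close>
    show "module K (cocycle_space C d n\<lparr>carrier := coboundaries C d n\<rparr>)"
      using submodule.submodule_is_module[OF coboundaries_submodule_cochains cochains_module]
      by (simp add: cocycle_space_def)
  qed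
qed

lemma cohomology_module: "module K (cohomology C d n)"
  unfolding cohomology_def
  by (rule quotient_module_module[OF cocycle_space_module coboundaries_submodule])

lemma carrier_cohomology: "carrier (cohomology C d n) = cohomology_class C d n ` cocycles C d n"
  using quotient_module_ops(1)[OF cocycle_space_module coboundaries_submodule]
  by (auto simp: cohomology_def cohomology_class_def cocycle_space_def)

lemma cohomology_class_hom:
  "cohomology_class C d n \<in> module_hom K (cocycle_space C d n) (cohomology C d n)"
  unfolding cohomology_def cohomology_class_def
  by (rule module_homI)
    (auto simp: quotient_module_ops(1-3)[OF cocycle_space_module coboundaries_submodule])

text \<open>Stated with a sum rather than a difference: \<open>cocycle_space C d n\<close> shares
  its addition with \<open>C n\<close>, whereas negation in HOL-Algebra is defined through the
  carrier.\<close>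

lemma cohomology_class_eq_iff:
  assumes x: "x \<in> cocycles C d n" and y: "y \<in> cocycles C d n"
  shows "cohomology_class C d n x = cohomology_class C d n y \<longleftrightarrow>
    (\<exists>b\<in>coboundaries C d n. x = b \<oplus>\<^bsub>C n\<^esub> y)"
proof -
  interpret Z: module K "cocycle_space C d n" by (rule cocycle_space_module)
  have xy: "x \<in> carrier (cocycle_space C d n)" "y \<in> carrier (cocycle_space C d n)"
    using x y by (auto simp: cocycle_space_def)
  have add: "add (C n) = add (cocycle_space C d n)" by (simp add: cocycle_space_def)
  have B: "b \<in> carrier (cocycle_space C d n)" if "b \<in> coboundaries C d n" for b
    using coboundaries_subset that by (auto simp: cocycle_space_def)
  have "x \<ominus>\<^bsub>cocycle_space C d n\<^esub> y \<in> coboundaries C d n \<longleftrightarrow>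
    (\<exists>b\<in>coboundaries C d n. x = b \<oplus>\<^bsub>C n\<^esub> y)"
    unfolding add
  proof
    assume "x \<ominus>\<^bsub>cocycle_space C d n\<^esub> y \<in> coboundaries C d n"
    moreover have "x = (x \<ominus>\<^bsub>cocycle_space C d n\<^esub> y) \<oplus>\<^bsub>cocycle_space C d n\<^esub> y"
      using xy by (simp add: Z.minus_add_cancel)
    ultimately show "\<exists>b\<in>coboundaries C d n. x = b \<oplus>\<^bsub>cocycle_space C d n\<^esub> y" by blast
  next
    assume "\<exists>b\<in>coboundaries C d n. x = b \<oplus>\<^bsub>cocycle_space C d n\<^esub> y"
    then show "x \<ominus>\<^bsub>cocycle_space C d n\<^esub> y \<in> coboundaries C d n"
      using xy(2) B by (auto simp: a_minus_def Z.a_assoc Z.r_neg)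
  qed
  then show ?thesis
    using quotient_module_ops(5)[OF cocycle_space_module coboundaries_submodule xy]
    by (simp add: cohomology_class_def)
qed

lemma cohomology_class_differential:
  assumes "x \<in> carrier (C n)"
  shows "cohomology_class C d (Suc n) (d n x) = \<zero>\<^bsub>cohomology C d (Suc n)\<^esub>"
proof -
  interpret C: module K "C (Suc n)" by (rule cochains_module)
  interpret Z: module K "cocycle_space C d (Suc n)" by (rule cocycle_space_module)
  have cl: "d n x \<in> carrier (C (Suc n))" by (rule module_homD(1)[OF differential_hom assms])
  have z: "\<zero>\<^bsub>cocycle_space C d (Suc n)\<^esub> = \<zero>\<^bsub>C (Suc n)\<^esub>" by (simp add: cocycle_space_def)
  have "d n x \<in> coboundaries C d (Suc n)" using assms by (simp add: coboundaries_def)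
  moreover have "\<zero>\<^bsub>C (Suc n)\<^esub> \<in> cocycles C d (Suc n)"
    using Z.zero_closed unfolding z by (simp add: cocycle_space_def)
  ultimately have "cohomology_class C d (Suc n) (d n x) = cohomology_class C d (Suc n) \<zero>\<^bsub>C (Suc n)\<^esub>"
    using cl coboundaries_subset by (subst cohomology_class_eq_iff) (auto intro!: bexI[of _ "d n x"])
  then show ?thesis
    using module_hom_zero[OF cocycle_space_module cohomology_module cohomology_class_hom, of "Suc n"]
    by (simp add: z)
qed

text \<open>A generalised inverse \<open>s\<close> of \<open>d n\<close> yields the projection
  \<open>x - s (d n x)\<close> onto cocycles; \<open>q\<close> is the class map after it. On a
  cocycle the correction term is \<open>s\<close> of zero.\<close>

lemma cohomology_class_extension:
  assumes "field K"
  obtains q where "q \<in> module_hom K (C n) (cohomology C d n)"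
    "\<And>z. z \<in> cocycles C d n \<Longrightarrow> q z = cohomology_class C d n z"
proof -
  interpret C: module K "C n" by (rule cochains_module)
  interpret C': module K "C (Suc n)" by (rule cochains_module)
  note D = differential_hom[of n]
  obtain s where s: "s \<in> module_hom K (C (Suc n)) (C n)"
    "\<And>x. x \<in> carrier (C n) \<Longrightarrow> d n (s (d n x)) = d n x"
    using generalised_inverse[OF assms cochains_module cochains_module D] by blast
  let ?\<pi> = "\<lambda>x. x \<ominus>\<^bsub>C n\<^esub> s (d n x)"
  have "?\<pi> \<in> module_hom K (C n) (C n)"
    using module_hom_minus[OF cochains_module module_hom_id module_hom_comp[OF D s(1)]] by simp
  moreover have "d n (?\<pi> x) = \<zero>\<^bsub>C (Suc n)\<^esub>" if "x \<in> carrier (C n)" for x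
    using that by (simp add: a_minus_def module_homD[OF D] module_homD[OF s(1)]
        module_hom_neg[OF cochains_module cochains_module D] s(2) C'.r_neg)
  ultimately have "?\<pi> \<in> module_hom K (C n) (cocycle_space C d n)"
    by (auto simp: module_hom_def cocycle_space_def cocycles_def)
  from module_hom_comp[OF this cohomology_class_hom]
  show ?thesis
  proof (rule that)
    fix z assume "z \<in> cocycles C d n"
    then have "?\<pi> z = z"
      using module_hom_zero[OF cochains_module cochains_module s(1)]
      by (simp add: cocycles_def a_minus_def)
    then show "cohomology_class C d n (?\<pi> z) = cohomology_class C d n z" by simp
  qed
qed

end

section \<open>Maps induced on cohomology\<close>

locale cochain_map = C: cochain_complex K C d + C': cochain_complex K C' d'
  for K :: "'k ring" and C :: "nat \<Rightarrow> ('k, 'a) module" and d :: "nat \<Rightarrow> 'a \<Rightarrow> 'a"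
    and C' :: "nat \<Rightarrow> ('k, 'b) module" and d' :: "nat \<Rightarrow> 'b \<Rightarrow> 'b" +
  fixes f :: "nat \<Rightarrow> 'a \<Rightarrow> 'b"
  assumes map_hom: "f n \<in> module_hom K (C n) (C' n)"
    and map_differential: "x \<in> carrier (C n) \<Longrightarrow> f (Suc n) (d n x) = d' n (f n x)"
begin

lemma map_cocycle: "x \<in> cocycles C d n \<Longrightarrow> f n x \<in> cocycles C' d' n"
  using module_hom_zero[OF C.cochains_module C'.cochains_module map_hom] module_homD(1)[OF map_hom]
  by (auto simp: cocycles_def map_differential[symmetric])

lemma map_coboundary: "b \<in> coboundaries C d n \<Longrightarrow> f n b \<in> coboundaries C' d' n"
  using module_hom_zero[OF C.cochains_module C'.cochains_module map_hom] module_homD(1)[OF map_hom]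
  by (auto simp: coboundaries_def map_differential split: nat.splits)

text \<open>Two representatives differ by a coboundary, which is mapped to a coboundary. Hence the
  definite description in \<open>cohomology_map\<close> has exactly one candidate.\<close>

lemma cohomology_map_class:
  assumes x: "x \<in> cocycles C d n"
  shows "cohomology_map C d C' d' f n (cohomology_class C d n x) = cohomology_class C' d' n (f n x)"
  unfolding cohomology_map_def
proof (rule the_equality)
  show "\<exists>y\<in>cocycles C d n. cohomology_class C d n x = cohomology_class C d n y \<and>
      cohomology_class C' d' n (f n x) = cohomology_class C' d' n (f n y)"
    using x by blast
  fix Y assume "\<exists>y\<in>cocycles C d n. cohomology_class C d n x = cohomology_class C d n y \<and>
      Y = cohomology_class C' d' n (f n y)"
  then obtain y where y: "y \<in> cocycles C d n" "Y = cohomology_class C' d' n (f n y)"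
    and "cohomology_class C d n x = cohomology_class C d n y" by blast
  then obtain b where b: "b \<in> coboundaries C d n" "x = b \<oplus>\<^bsub>C n\<^esub> y"
    using C.cohomology_class_eq_iff[OF x y(1)] by blast
  have "b \<in> carrier (C n)" "y \<in> carrier (C n)"
    using b y C.coboundaries_subset by (auto simp: cocycles_def)
  then have "f n x = f n b \<oplus>\<^bsub>C' n\<^esub> f n y" using b module_homD(2)[OF map_hom] by simp
  then show "Y = cohomology_class C' d' n (f n x)"
    using C'.cohomology_class_eq_iff[OF map_cocycle[OF x] map_cocycle[OF y(1)]]
      map_coboundary[OF b(1)] y(2) by auto
qed

lemma cohomology_map_hom:
  "cohomology_map C d C' d' f n \<in> module_hom K (cohomology C d n) (cohomology C' d' n)"
proof (rule module_homI)
  interpret Z: module K "cocycle_space C d n" by (rule C.cocycle_space_module)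
  have Zc: "carrier (cocycle_space C d n) = cocycles C d n"
    "add (cocycle_space C d n) = add (C n)" "smult (cocycle_space C d n) = smult (C n)"
    "carrier (cocycle_space C' d' n) = cocycles C' d' n"
    "add (cocycle_space C' d' n) = add (C' n)" "smult (cocycle_space C' d' n) = smult (C' n)"
    by (auto simp: cocycle_space_def)
  note cD = module_homD[OF C.cohomology_class_hom[of n], unfolded Zc]
      module_homD[OF C'.cohomology_class_hom[of n], unfolded Zc]
    and cl = Z.add.m_closed[unfolded Zc] Z.smult_closed[unfolded Zc]
  have sub: "x \<in> carrier (C n)" if "x \<in> cocycles C d n" for x using that by (simp add: cocycles_def)
  fix X assume "X \<in> carrier (cohomology C d n)"
  then obtain x where x: "x \<in> cocycles C d n" "X = cohomology_class C d n x"
    by (auto simp: C.carrier_cohomology)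
  show "cohomology_map C d C' d' f n X \<in> carrier (cohomology C' d' n)"
    using x by (simp add: cohomology_map_class cD map_cocycle)
  { fix c assume c: "c \<in> carrier K"
    have "c \<odot>\<^bsub>cohomology C d n\<^esub> X = cohomology_class C d n (c \<odot>\<^bsub>C n\<^esub> x)"
      using x c by (simp add: cD)
    then show "cohomology_map C d C' d' f n (c \<odot>\<^bsub>cohomology C d n\<^esub> X) =
        c \<odot>\<^bsub>cohomology C' d' n\<^esub> cohomology_map C d C' d' f n X"
      using x c cl by (simp add: cohomology_map_class cD(4-6) map_cocycle module_homD(3)[OF map_hom] sub) }
  { fix Y assume "Y \<in> carrier (cohomology C d n)"
    then obtain y where y: "y \<in> cocycles C d n" "Y = cohomology_class C d n y"
      by (auto simp: C.carrier_cohomology)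
    have "X \<oplus>\<^bsub>cohomology C d n\<^esub> Y = cohomology_class C d n (x \<oplus>\<^bsub>C n\<^esub> y)"
      using x y by (simp add: cD)
    then show "cohomology_map C d C' d' f n (X \<oplus>\<^bsub>cohomology C d n\<^esub> Y) =
        cohomology_map C d C' d' f n X \<oplus>\<^bsub>cohomology C' d' n\<^esub> cohomology_map C d C' d' f n Y"
      using x y cl by (simp add: cohomology_map_class cD(4-6) map_cocycle module_homD(2)[OF map_hom] sub) }
qed

end

section \<open>Left invariant forms\<close>

context bicovariant_calculus
begin

sublocale complex: cochain_complex K \<Omega> d
  by (intro cochain_complex.intro forms_module d_hom d_d)

abbreviation coact :: "nat \<Rightarrow> 'a \<Rightarrow> ('k, 'a, 'a) tensor" where
  "coact \<equiv> form_coaction \<Delta>s"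

lemma P_module: "module K P"
  using forms_module[of 0] by (simp add: forms_zero)

lemma comult_component_hom:
  assumes "r \<le> n"
  shows "(\<lambda>\<omega>. \<Delta>s n \<omega> r) \<in> module_hom K (\<Omega> n) (tensor K (\<Omega> r) (\<Omega> (n - r)))"
  by (rule module_homI)
    (use assms module_homD[OF comult_forms_hom[of n]] in \<open>auto simp: tensor_forms_def direct_sum_def PiE_iff\<close>)

lemma coact_hom: "coact n \<in> module_hom K (\<Omega> n) (tensor K P (\<Omega> n))"
  using coaction_forms[of n] by (simp add: left_coaction_def)

lemma coact_closed: "\<omega> \<in> carrier (\<Omega> n) \<Longrightarrow> coact n \<omega> \<in> carrier (tensor K P (\<Omega> n))"
  by (rule module_homD(1)[OF coact_hom])

text \<open>In component 0 of \<open>tensor_d\<close> the summand \<open>d \<otimes> id\<close> is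
  absent and \<open>id \<otimes> d\<close> carries the sign of degree 0, which is plus.\<close>

lemma coact_d:
  assumes "\<omega> \<in> carrier (\<Omega> n)"
  shows "coact (Suc n) (d n \<omega>) = tensor_map K P (\<Omega> n) P (\<Omega> (Suc n)) id (d n) (coact n \<omega>)"
proof -
  interpret T: module K "tensor K P (\<Omega> (Suc n))" by (rule tensor_module[OF P_module forms_module])
  have "tensor_map K P (\<Omega> n) P (\<Omega> (Suc n)) id (d n) (coact n \<omega>) \<in> carrier (tensor K P (\<Omega> (Suc n)))"
    by (rule module_homD(1)[OF tensor_map(1) coact_closed[OF assms]])
      (rule P_module forms_module module_hom_id d_hom)+
  then show ?thesis
    using comult_forms_d[OF assms]
    by (simp add: form_coaction_def tensor_d_def Let_def signed_def forms_zero)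
qed

section \<open>The induced coaction on cohomology\<close>

text \<open>The definite description of the induced coaction is resolved here. The extension
  \<open>q\<close> gives a formula on all of \<open>P \<otimes> \<Omega> n\<close> that mentions no
  preimage \<open>y\<close>, and it depends only on the class because \<open>id \<otimes> q\<close>
  kills coactions of coboundaries.\<close>

lemma cohomology_coaction_class:
  assumes q: "q \<in> module_hom K (\<Omega> n) (cohomology \<Omega> d n)"
    "\<And>z. z \<in> cocycles \<Omega> d n \<Longrightarrow> q z = cohomology_class \<Omega> d n z"
    and \<omega>: "\<omega> \<in> cocycles \<Omega> d n"
  shows "cohomology_coaction K P \<Omega> d \<Delta>s n (cohomology_class \<Omega> d n \<omega>) =
    tensor_map K P (\<Omega> n) P (cohomology \<Omega> d n) id q (coact n \<omega>)"
proof -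
  let ?Z = "cocycle_space \<Omega> d n" and ?H = "cohomology \<Omega> d n"
  let ?q = "tensor_map K P (\<Omega> n) P ?H id q"
  note P = P_module and F = forms_module and Z = complex.cocycle_space_module
    and H = complex.cohomology_module
  note PF = tensor_module[OF P F] and PH = tensor_module[OF P H]
  interpret PH: module K "tensor K P ?H" by (rule PH)
  have Zc: "carrier ?Z = cocycles \<Omega> d n" by (simp add: cocycle_space_def)
  have sub: "z \<in> carrier (\<Omega> n)" if "z \<in> cocycles \<Omega> d n" for z using that by (simp add: cocycles_def)
  have inc: "id \<in> module_hom K ?Z (\<Omega> n)"
    by (auto simp: module_hom_def cocycle_space_def cocycles_def)
  have qh: "?q \<in> module_hom K (tensor K P (\<Omega> n)) (tensor K P ?H)"
    by (rule tensor_map(1)[OF P F P H module_hom_id q(1)])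
  have q_embed: "?q (tensor_map K P ?Z P (\<Omega> n) id id y) =
      tensor_map K P ?Z P ?H id (cohomology_class \<Omega> d n) y" if "y \<in> carrier (tensor K P ?Z)" for y
    by (rule tensor_map_eqI[OF P Z P H P F module_hom_id inc module_hom_id q(1) module_hom_id
          complex.cohomology_class_hom _ _ that]) (simp_all add: Zc q(2))
  \<comment> \<open>In positive degree, \<open>coact\<close> turns \<open>d\<close> into
    \<open>id \<otimes> d\<close>, and \<open>q\<close> vanishes on exact forms. In degree 0 the
    only coboundary is zero.\<close>
  have q_cob: "?q (coact n b) = \<zero>\<^bsub>tensor K P ?H\<^esub>" if b: "b \<in> coboundaries \<Omega> d n" for b
  proof (cases n)
    case 0
    with b have "b = \<zero>\<^bsub>\<Omega> n\<^esub>" by (simp add: coboundaries_def)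
    then show ?thesis
      using module_hom_zero[OF F PF coact_hom] module_hom_zero[OF PF PH qh] by simp
  next
    case (Suc m)
    with b obtain \<eta> where \<eta>: "\<eta> \<in> carrier (\<Omega> m)" "b = d m \<eta>" by (auto simp: coboundaries_def)
    have qd: "q (d m x) = \<zero>\<^bsub>?H\<^esub>" if "x \<in> carrier (\<Omega> m)" for x
    proof -
      have "d m x \<in> coboundaries \<Omega> d n" using that by (simp add: coboundaries_def Suc)
      then show ?thesis
        using q(2)[OF subsetD[OF complex.coboundaries_subset]] complex.cohomology_class_differential[OF that] Suc
        by simp
    qed
    have dm: "d m \<in> module_hom K (\<Omega> m) (\<Omega> n)" using d_hom[of m] Suc by simp
    have "?q (coact n b) = ?q (tensor_map K P (\<Omega> m) P (\<Omega> n) id (d m) (coact m \<eta>))"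
      using coact_d[OF \<eta>(1)] \<eta>(2) Suc by simp
    also have "\<dots> = tensor_map K P (\<Omega> m) P ?H id (\<lambda>x. q (d m x)) (coact m \<eta>)"
      by (rule tensor_map_eqI[OF P F P H P F module_hom_id dm module_hom_id q(1) module_hom_id
            module_hom_comp[OF dm q(1)] _ _ coact_closed[OF \<eta>(1)]]) simp_all
    also have "\<dots> = \<zero>\<^bsub>tensor K P ?H\<^esub>"
      by (rule tensor_map_zero_right[OF P F P H module_hom_id module_hom_comp[OF dm q(1)] qd
            coact_closed[OF \<eta>(1)]])
    finally show ?thesis .
  qed
  show ?thesis
    unfolding cohomology_coaction_def Let_def
  proof (rule the_equality)
    have dn: "d n \<omega> = \<zero>\<^bsub>\<Omega> (Suc n)\<^esub>" using \<omega> by (simp add: cocycles_def)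
    \<comment> \<open>The coaction of a closed form is killed by \<open>id \<otimes> d\<close>, so
      by exactness it comes from \<open>P \<otimes> ker d\<close>; this supplies the witness
      \<open>y\<close>.\<close>
    have "tensor_map K P (\<Omega> n) P (\<Omega> (Suc n)) id (d n) (coact n \<omega>) = \<zero>\<^bsub>tensor K P (\<Omega> (Suc n))\<^esub>"
      using coact_d[OF sub[OF \<omega>]] module_hom_zero[OF F tensor_module[OF P F] coact_hom] dn by simp
    from tensor_kernel[OF field_axioms P F F d_hom coact_closed[OF sub[OF \<omega>]] this]
    obtain y where y: "y \<in> carrier (tensor K P ?Z)" "tensor_map K P ?Z P (\<Omega> n) id id y = coact n \<omega>"
      unfolding cocycle_space_def cocycles_def by blast
    then show "\<exists>\<omega>'\<in>carrier ?Z. \<exists>y\<in>carrier (tensor K P ?Z).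
        cohomology_class \<Omega> d n \<omega> = cohomology_class \<Omega> d n \<omega>' \<and>
        tensor_map K P ?Z P (\<Omega> n) id id y = coact n \<omega>' \<and>
        ?q (coact n \<omega>) = tensor_map K P ?Z P ?H id (cohomology_class \<Omega> d n) y"
      using \<omega> q_embed[OF y(1)] by (auto simp: Zc)
  next
    fix t assume "\<exists>\<omega>'\<in>carrier ?Z. \<exists>y\<in>carrier (tensor K P ?Z).
        cohomology_class \<Omega> d n \<omega> = cohomology_class \<Omega> d n \<omega>' \<and>
        tensor_map K P ?Z P (\<Omega> n) id id y = coact n \<omega>' \<and>
        t = tensor_map K P ?Z P ?H id (cohomology_class \<Omega> d n) y"
    then obtain \<omega>' y where \<omega>': "\<omega>' \<in> cocycles \<Omega> d n"
      "cohomology_class \<Omega> d n \<omega> = cohomology_class \<Omega> d n \<omega>'"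
      and y: "y \<in> carrier (tensor K P ?Z)" "tensor_map K P ?Z P (\<Omega> n) id id y = coact n \<omega>'"
      and t: "t = tensor_map K P ?Z P ?H id (cohomology_class \<Omega> d n) y"
      by (auto simp: Zc)
    obtain b where b: "b \<in> coboundaries \<Omega> d n" "\<omega> = b \<oplus>\<^bsub>\<Omega> n\<^esub> \<omega>'"
      using complex.cohomology_class_eq_iff[OF \<omega> \<omega>'(1)] \<omega>'(2) by blast
    have cl: "b \<in> carrier (\<Omega> n)" "\<omega>' \<in> carrier (\<Omega> n)"
      using b(1) \<omega>'(1) complex.coboundaries_subset sub by blast+
    have "?q (coact n \<omega>) = ?q (coact n b) \<oplus>\<^bsub>tensor K P ?H\<^esub> ?q (coact n \<omega>')"
      unfolding b(2) using cl by (simp add: module_homD(2)[OF coact_hom] module_homD(2)[OF qh] coact_closed)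
    also have "\<dots> = ?q (coact n \<omega>')"
      using q_cob[OF b(1)] module_homD(1)[OF qh coact_closed[OF cl(2)]] by simp
    also have "\<dots> = t" using q_embed[OF y(1)] y(2) t by simp
    finally show "t = ?q (coact n \<omega>)" by simp
  qed
qed

text \<open>The \<open>\<Omega> 1 \<otimes> \<Omega> n\<close> component of \<open>d (\<Delta>s \<omega>) = \<Delta>s (d \<omega>) = 0\<close> equates \<open>d \<otimes> id\<close> of the
  \<open>P \<otimes> \<Omega> n\<close> component of \<open>\<Delta>s \<omega>\<close> with \<open>id \<otimes> d\<close> of the \<open>\<Omega> 1 \<otimes> \<Omega> (n - 1)\<close> component, which is
  exact in the second leg.\<close>

lemma coaction_class_closed:
  assumes q: "q \<in> module_hom K (\<Omega> n) (cohomology \<Omega> d n)"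
    "\<And>z. z \<in> cocycles \<Omega> d n \<Longrightarrow> q z = cohomology_class \<Omega> d n z"
    and \<omega>: "\<omega> \<in> cocycles \<Omega> d n"
  shows "tensor_map K P (cohomology \<Omega> d n) (\<Omega> 1) (cohomology \<Omega> d n) (d 0) id
      (tensor_map K P (\<Omega> n) P (cohomology \<Omega> d n) id q (coact n \<omega>)) =
    \<zero>\<^bsub>tensor K (\<Omega> 1) (cohomology \<Omega> d n)\<^esub>"
proof -
  let ?H = "cohomology \<Omega> d n" and ?T = "tensor K (\<Omega> 1) (\<Omega> n)"
  note P = P_module and F = forms_module and H = complex.cohomology_module
  note T = tensor_module[OF F F] and TH = tensor_module[OF F H]
  interpret T: module K ?T by (rule T)
  interpret TH: module K "tensor K (\<Omega> 1) ?H" by (rule TH)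
  have \<omega>c: "\<omega> \<in> carrier (\<Omega> n)" and dn: "d n \<omega> = \<zero>\<^bsub>\<Omega> (Suc n)\<^esub>" using \<omega> by (auto simp: cocycles_def)
  have d0: "d 0 \<in> module_hom K P (\<Omega> 1)" using d_hom[of 0] by (simp add: forms_zero)
  let ?q = "tensor_map K (\<Omega> 1) (\<Omega> n) (\<Omega> 1) ?H id q"
  let ?x = "tensor_map K P (\<Omega> n) (\<Omega> 1) (\<Omega> n) (d 0) id (coact n \<omega>)"
  note qh = tensor_map(1)[OF F F F H module_hom_id q(1), of 1]
  have xc: "?x \<in> carrier ?T"
    by (rule module_homD(1)[OF tensor_map(1)[OF P F F F d0 module_hom_id] coact_closed[OF \<omega>c]])
  have "\<Delta>s (Suc n) (d n \<omega>) 1 = \<zero>\<^bsub>?T\<^esub>"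
    using module_hom_zero[OF F _ comult_component_hom[of 1 "Suc n"]] T dn by simp
  \<comment> \<open>Component 1 of the differential. For \<open>n = 0\<close> it is the top
    component, which receives no \<open>id \<otimes> d\<close> term; otherwise that term carries the
    sign of degree 1, which is minus.\<close>
  then have eq: "?x \<oplus>\<^bsub>?T\<^esub> (if n = 0 then \<zero>\<^bsub>?T\<^esub> else \<ominus>\<^bsub>?T\<^esub>
      tensor_map K (\<Omega> 1) (\<Omega> (n - 1)) (\<Omega> 1) (\<Omega> n) id (d (n - 1)) (\<Delta>s n \<omega> 1)) = \<zero>\<^bsub>?T\<^esub>"
    unfolding comult_forms_d[OF \<omega>c]
    by (simp add: tensor_d_def Let_def signed_def forms_zero form_coaction_def split: if_splits)
  have "?q ?x = \<zero>\<^bsub>tensor K (\<Omega> 1) ?H\<^esub>"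
  proof (cases n)
    case 0
    then have "?x = \<zero>\<^bsub>?T\<^esub>" using eq T.r_zero[OF xc] by argo
    then show ?thesis using module_hom_zero[OF T TH qh] by simp
  next
    case (Suc m)
    let ?y = "tensor_map K (\<Omega> 1) (\<Omega> m) (\<Omega> 1) (\<Omega> n) id (d m) (\<Delta>s n \<omega> 1)"
    have dm: "d m \<in> module_hom K (\<Omega> m) (\<Omega> n)" using d_hom[of m] Suc by simp
    have c1: "\<Delta>s n \<omega> 1 \<in> carrier (tensor K (\<Omega> 1) (\<Omega> m))"
      using module_homD(1)[OF comult_component_hom[of 1 n] \<omega>c] Suc by simp
    have yc: "?y \<in> carrier ?T"
      by (rule module_homD(1)[OF tensor_map(1)[OF F F F F module_hom_id dm] c1])
    have qd: "q (d m x) = \<zero>\<^bsub>?H\<^esub>" if "x \<in> carrier (\<Omega> m)" for x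
    proof -
      have "d m x \<in> coboundaries \<Omega> d n" using that by (simp add: coboundaries_def Suc)
      then show ?thesis
        using q(2)[OF subsetD[OF complex.coboundaries_subset]] complex.cohomology_class_differential[OF that] Suc
        by simp
    qed
    have "?x \<ominus>\<^bsub>?T\<^esub> ?y = \<zero>\<^bsub>?T\<^esub>" using eq by (simp add: Suc a_minus_def)
    then have "?x = ?y" using T.minus_eq_zero_iff[OF xc yc] by blast
    then have "?q ?x = ?q ?y" by simp
    also have "\<dots> = tensor_map K (\<Omega> 1) (\<Omega> m) (\<Omega> 1) ?H id (\<lambda>x. q (d m x)) (\<Delta>s n \<omega> 1)"
      by (rule tensor_map_eqI[OF F F F H F F module_hom_id dm module_hom_id q(1) module_hom_id
            module_hom_comp[OF dm q(1)] _ _ c1]) simp_all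
    also have "\<dots> = \<zero>\<^bsub>tensor K (\<Omega> 1) ?H\<^esub>"
      by (rule tensor_map_zero_right[OF F F F H module_hom_id module_hom_comp[OF dm q(1)] qd c1])
    finally show ?thesis .
  qed
  moreover have "?q ?x = tensor_map K P (\<Omega> n) (\<Omega> 1) ?H (d 0) q (coact n \<omega>)"
    by (rule tensor_map_eqI[OF P F F H F F d0 module_hom_id module_hom_id q(1) d0 q(1) _ _
          coact_closed[OF \<omega>c]]) simp_all
  \<comment> \<open>Both orders of applying \<open>d\<close> in the first leg and \<open>q\<close>
    in the second give \<open>d \<otimes> q\<close>.\<close>
  moreover have "tensor_map K P ?H (\<Omega> 1) ?H (d 0) id (tensor_map K P (\<Omega> n) P ?H id q (coact n \<omega>)) =
      tensor_map K P (\<Omega> n) (\<Omega> 1) ?H (d 0) q (coact n \<omega>)"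
    by (rule tensor_map_eqI[OF P F F H P H module_hom_id q(1) d0 module_hom_id d0 q(1) _ _
          coact_closed[OF \<omega>c]]) simp_all
  ultimately show ?thesis by simp
qed

section \<open>Connected calculi\<close>

text \<open>With \<open>s\<close> a generalised inverse of \<open>d 0\<close>, the projection
  \<open>p - s (d 0 p)\<close> lands in \<open>ker d = K 1\<close>. Tensoring the splitting of
  \<open>p\<close> with \<open>H\<close> writes \<open>t\<close> as a tensor
  \<open>1 \<otimes> h\<close> plus a term that factors through
  \<open>d \<otimes> id\<close>.\<close>

lemma connected_tensor_kernel:
  assumes con: "connected_calculus K P \<Omega> d" and H: "module K H"
    and t: "t \<in> carrier (tensor K P H)"
    and ker: "tensor_map K P H (\<Omega> 1) H (d 0) id t = \<zero>\<^bsub>tensor K (\<Omega> 1) H\<^esub>"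
  obtains h where "h \<in> carrier H" "t = pure K P H \<one>\<^bsub>P\<^esub> h"
proof -
  note P = P_module and F = forms_module
  note PH = tensor_module[OF P H] and FH = tensor_module[OF F H, of 1]
  interpret H: module K H by (rule H)
  interpret F1: module K "\<Omega> 1" by (rule F)
  interpret PH: module K "tensor K P H" by (rule PH)
  have d0: "d 0 \<in> module_hom K P (\<Omega> 1)" using d_hom[of 0] by (simp add: forms_zero)
  obtain s where s: "s \<in> module_hom K (\<Omega> 1) P" "\<And>x. x \<in> carrier P \<Longrightarrow> d 0 (s (d 0 x)) = d 0 x"
    using generalised_inverse[OF field_axioms P F d0] by blast
  let ?\<pi> = "\<lambda>x. x \<ominus>\<^bsub>P\<^esub> s (d 0 x)"
  note dD = module_homD[OF d0] and sD = module_homD[OF s(1)]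
  have \<pi>: "?\<pi> \<in> module_hom K P P"
    using module_hom_minus[OF P module_hom_id module_hom_comp[OF d0 s(1)]] by simp
  \<comment> \<open>The projected element is a multiple of the unit, and the counit reads off its
    coefficient since \<open>\<epsilon> \<one> = \<one>\<close>.\<close>
  define \<phi> where "\<phi> = (\<lambda>p. \<epsilon> (?\<pi> p))"
  have \<phi>: "\<phi> \<in> module_hom K P (self_module K)"
    unfolding \<phi>_def by (rule module_hom_comp[OF \<pi> counit_hom])
  have \<phi>c: "\<phi> p \<in> carrier K" if "p \<in> carrier P" for p
    using module_homD(1)[OF \<phi> that] by (simp add: self_module_def)
  have \<pi>_one: "?\<pi> p = \<phi> p \<odot>\<^bsub>P\<^esub> \<one>\<^bsub>P\<^esub>" if p: "p \<in> carrier P" for p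
  proof -
    have "d 0 (?\<pi> p) = \<zero>\<^bsub>\<Omega> 1\<^esub>"
      using p by (simp add: a_minus_def dD sD module_hom_neg[OF P F d0] s(2) F1.r_neg del: One_nat_def)
    then obtain c where c: "c \<in> carrier K" "?\<pi> p = c \<odot>\<^bsub>P\<^esub> \<one>\<^bsub>P\<^esub>"
      using con module_homD(1)[OF \<pi> p] unfolding connected_calculus_def by blast
    have "\<phi> p = c"
      unfolding \<phi>_def c(2) using module_homD(3)[OF counit_hom c(1) one_closed] c(1)
      by (simp add: counit_one self_module_def)
    then show ?thesis using c by simp
  qed
  note md = tensor_map[OF P H F H d0 module_hom_id] and ms = tensor_map[OF F H P H s(1) module_hom_id]
    and sl = slice[OF P H \<phi>]
  have "pure K P H \<one>\<^bsub>P\<^esub> (slice K P \<phi> H t) \<oplus>\<^bsub>tensor K P H\<^esub>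
      tensor_map K (\<Omega> 1) H P H s id (tensor_map K P H (\<Omega> 1) H (d 0) id t) = t"
  proof (rule tensor_hom_eqI[OF P H PH _ module_hom_id[unfolded id_def] _ t])
    show "(\<lambda>t. pure K P H \<one>\<^bsub>P\<^esub> (slice K P \<phi> H t) \<oplus>\<^bsub>tensor K P H\<^esub>
      tensor_map K (\<Omega> 1) H P H s id (tensor_map K P H (\<Omega> 1) H (d 0) id t))
      \<in> module_hom K (tensor K P H) (tensor K P H)"
      by (rule module_hom_add[OF PH module_hom_comp[OF sl(1) pure_hom(1)[OF P H one_closed]]
            module_hom_comp[OF md(1) ms(1)]])
    fix p h assume ph: "p \<in> carrier P" "h \<in> carrier H"
    have "pure K P H \<one>\<^bsub>P\<^esub> (\<phi> p \<odot>\<^bsub>H\<^esub> h) = pure K P H (?\<pi> p) h"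
      unfolding \<pi>_one[OF ph(1)] using ph \<phi>c
      by (simp add: module_homD(3)[OF pure_hom(1)[OF P H]] module_homD(3)[OF pure_hom(2)[OF P H]])
    then have "pure K P H \<one>\<^bsub>P\<^esub> (\<phi> p \<odot>\<^bsub>H\<^esub> h) \<oplus>\<^bsub>tensor K P H\<^esub> pure K P H (s (d 0 p)) h =
        pure K P H (?\<pi> p \<oplus>\<^bsub>P\<^esub> s (d 0 p)) h"
      using ph by (simp add: module_homD(2)[OF pure_hom(2)[OF P H]] dD sD del: One_nat_def)
    also have "?\<pi> p \<oplus>\<^bsub>P\<^esub> s (d 0 p) = p"
      using ph by (simp add: abelian_group.minus_add_cancel[OF module.axioms(2)[OF P]] dD sD del: One_nat_def)
    finally show "pure K P H \<one>\<^bsub>P\<^esub> (slice K P \<phi> H (pure K P H p h)) \<oplus>\<^bsub>tensor K P H\<^esub>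
        tensor_map K (\<Omega> 1) H P H s id (tensor_map K P H (\<Omega> 1) H (d 0) id (pure K P H p h)) =
        pure K P H p h"
      using ph by (simp add: sl md ms dD del: One_nat_def)
  qed
  then have "t = pure K P H \<one>\<^bsub>P\<^esub> (slice K P \<phi> H t)"
    using module_homD(1)[OF sl(1) t]
    by (simp add: ker module_hom_zero[OF FH PH ms(1)] pure_closed[OF P H] del: One_nat_def)
  then show ?thesis using that module_homD(1)[OF sl(1) t] by blast
qed

lemma connected_coinvariants:
  assumes con: "connected_calculus K P \<Omega> d"
  shows "coinvariants K P (cohomology \<Omega> d n) (cohomology_coaction K P \<Omega> d \<Delta>s n) =
    carrier (cohomology \<Omega> d n)"
proof (intro equalityI subsetI)
  let ?H = "cohomology \<Omega> d n"
  note P = P_module and F = forms_module and H = complex.cohomology_module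
  interpret H: module K ?H by (rule H)
  fix X assume X: "X \<in> carrier ?H"
  then obtain \<omega> where \<omega>: "\<omega> \<in> cocycles \<Omega> d n" "X = cohomology_class \<Omega> d n \<omega>"
    by (auto simp: complex.carrier_cohomology)
  have \<omega>c: "\<omega> \<in> carrier (\<Omega> n)" using \<omega> by (simp add: cocycles_def)
  obtain q where q: "q \<in> module_hom K (\<Omega> n) ?H"
    "\<And>z. z \<in> cocycles \<Omega> d n \<Longrightarrow> q z = cohomology_class \<Omega> d n z"
    using complex.cohomology_class_extension[OF field_axioms] by blast
  let ?t = "tensor_map K P (\<Omega> n) P ?H id q (coact n \<omega>)"
  have t: "?t \<in> carrier (tensor K P ?H)"
    by (rule module_homD(1)[OF tensor_map(1)[OF P F P H module_hom_id q(1)] coact_closed[OF \<omega>c]])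
  obtain h where h: "h \<in> carrier ?H" "?t = pure K P ?H \<one>\<^bsub>P\<^esub> h"
    using connected_tensor_kernel[OF con H t coaction_class_closed[OF q \<omega>(1)]] by blast
  \<comment> \<open>Contracting with the counit is evaluated in two ways: by the counit axiom for
    forms it gives the class \<open>X\<close>, and on \<open>1 \<otimes> h\<close> it gives
    \<open>h\<close>.\<close>
  have "slice K P \<epsilon> ?H ?t = q (slice K P \<epsilon> (\<Omega> n) (coact n \<omega>))"
    by (rule slice_tensor_map[OF P F H counit_hom q(1) coact_closed[OF \<omega>c]])
  also have "slice K P \<epsilon> (\<Omega> n) (coact n \<omega>) = \<omega>"
    using coaction_forms[of n] \<omega>c by (simp add: left_coaction_def)
  also have "q \<omega> = X" using q(2) \<omega> by simp
  finally have "slice K P \<epsilon> ?H ?t = X" .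
  moreover have "slice K P \<epsilon> ?H ?t = h"
    unfolding h(2) using slice(2)[OF P H counit_hom one_closed h(1)] h(1) by (simp add: counit_one)
  ultimately show "X \<in> coinvariants K P ?H (cohomology_coaction K P \<Omega> d \<Delta>s n)"
    using X h(2) cohomology_coaction_class[OF q \<omega>(1)] \<omega>(2) by (simp add: coinvariants_def)
qed (simp add: coinvariants_def)

section \<open>The subcomplex of invariant forms\<close>

abbreviation inv_forms :: "nat \<Rightarrow> ('k, 'a) module" where
  "inv_forms \<equiv> invariant_forms K P \<Omega> \<Delta>s"

lemma d_coinvariant:
  assumes "\<omega> \<in> coinvariants K P (\<Omega> n) (coact n)"
  shows "d n \<omega> \<in> coinvariants K P (\<Omega> (Suc n)) (coact (Suc n))"
  using assms tensor_map(2)[OF P_module forms_module P_module forms_module module_hom_id d_hom[of n] one_closed]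
  by (auto simp: coinvariants_def coact_d module_homD(1)[OF d_hom])

lemma invariant_complex: "cochain_complex K inv_forms d"
proof (rule cochain_complex.intro)
  show "module K (inv_forms n)" for n
    unfolding invariant_forms_def
    by (rule submodule.submodule_is_module[OF coinvariants_submodule])
      (rule P_module forms_module coact_hom one_closed)+
  show "d n \<in> module_hom K (inv_forms n) (inv_forms (Suc n))" for n
    using d_hom[of n] d_coinvariant
    by (auto simp: module_hom_def invariant_forms_def coinvariants_def)
  show "d (Suc n) (d n x) = \<zero>\<^bsub>inv_forms (Suc (Suc n))\<^esub>" if "x \<in> carrier (inv_forms n)" for x n
    using that d_d by (simp add: invariant_forms_def coinvariants_def)
qed

lemma inclusion_cochain_map: "cochain_map K inv_forms d \<Omega> d (\<lambda>m \<omega>. \<omega>)"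
  by (intro cochain_map.intro invariant_complex complex.cochain_complex_axioms
      cochain_map_axioms.intro)
    (auto simp: module_hom_def invariant_forms_def coinvariants_def)

text \<open>For an invariant cocycle, \<open>id \<otimes> q\<close> sends
  \<open>1 \<otimes> \<omega>\<close> to \<open>1 \<otimes> [\<omega>]\<close>. Thus the map induced
  by the inclusion takes values in the invariant classes.\<close>

lemma coaction_invariant_class:
  assumes "\<omega> \<in> cocycles inv_forms d n"
  shows "cohomology_class \<Omega> d n \<omega> \<in>
    coinvariants K P (cohomology \<Omega> d n) (cohomology_coaction K P \<Omega> d \<Delta>s n)"
proof -
  have \<omega>: "\<omega> \<in> cocycles \<Omega> d n" "coact n \<omega> = pure K P (\<Omega> n) \<one>\<^bsub>P\<^esub> \<omega>"
    using assms by (auto simp: cocycles_def invariant_forms_def coinvariants_def)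
  obtain q where q: "q \<in> module_hom K (\<Omega> n) (cohomology \<Omega> d n)"
    "\<And>z. z \<in> cocycles \<Omega> d n \<Longrightarrow> q z = cohomology_class \<Omega> d n z"
    using complex.cohomology_class_extension[OF field_axioms] by blast
  have "\<omega> \<in> carrier (\<Omega> n)" using \<omega>(1) by (simp add: cocycles_def)
  then show ?thesis
    using cohomology_coaction_class[OF q \<omega>(1)] q(2)[OF \<omega>(1)] \<omega>
      tensor_map(2)[OF P_module forms_module P_module complex.cohomology_module module_hom_id q(1) one_closed]
    by (auto simp: coinvariants_def complex.carrier_cohomology)
qed

section \<open>The averaging projection and the isomorphism\<close>

context
  fixes I assumes I: "normalised_left_integral K P \<Delta> I"
begin

definition average :: "nat \<Rightarrow> 'a \<Rightarrow> 'a" where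
  "average n \<omega> = slice K P I (\<Omega> n) (coact n \<omega>)"

lemma integral: "left_integral K P \<Delta> I" "I \<in> module_hom K P (self_module K)"
  using I by (auto simp: normalised_left_integral_def left_integral_def)

lemma average_hom: "average n \<in> module_hom K (\<Omega> n) (\<Omega> n)"
  unfolding average_def
  by (rule module_hom_comp[OF coact_hom slice(1)[OF P_module forms_module integral(2)]])

lemma average_coinvariant:
  "\<omega> \<in> carrier (\<Omega> n) \<Longrightarrow> average n \<omega> \<in> carrier (inv_forms n)"
  using integral_slice_coinvariant[OF P_module forms_module one_closed comult_hom coaction_forms integral(1)]
  by (simp add: average_def invariant_forms_def)

lemma average_id: "\<omega> \<in> carrier (inv_forms n) \<Longrightarrow> average n \<omega> = \<omega>"
  using integral_slice_one[OF P_module forms_module one_closed I]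
  by (simp add: average_def invariant_forms_def coinvariants_def)

text \<open>The coaction intertwines \<open>d\<close> with \<open>id \<otimes> d\<close>, and
  contraction of the first leg commutes with maps on the second.\<close>

lemma average_d: "\<omega> \<in> carrier (\<Omega> n) \<Longrightarrow> average (Suc n) (d n \<omega>) = d n (average n \<omega>)"
  using slice_tensor_map[OF P_module forms_module forms_module integral(2) d_hom coact_closed]
  by (simp add: average_def coact_d)

lemma average_cocycle:
  assumes "\<omega> \<in> cocycles \<Omega> d n"
  shows "average n \<omega> \<in> cocycles inv_forms d n"
  using assms average_coinvariant average_d[of \<omega> n]
    module_hom_zero[OF forms_module forms_module average_hom]
  by (auto simp: cocycles_def invariant_forms_def)

text \<open>Applying \<open>q\<close> after the contraction equals contracting after
  \<open>id \<otimes> q\<close>. The latter acts on the coaction of the class, which is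
  \<open>1 \<otimes> [\<omega>]\<close> by invariance, and a normalised integral returns
  \<open>[\<omega>]\<close>.\<close>

lemma average_class:
  assumes \<omega>: "\<omega> \<in> cocycles \<Omega> d n"
    and inv: "cohomology_class \<Omega> d n \<omega> \<in>
      coinvariants K P (cohomology \<Omega> d n) (cohomology_coaction K P \<Omega> d \<Delta>s n)"
  shows "cohomology_class \<Omega> d n (average n \<omega>) = cohomology_class \<Omega> d n \<omega>"
proof -
  let ?H = "cohomology \<Omega> d n"
  note P = P_module and F = forms_module and H = complex.cohomology_module
  have \<omega>c: "\<omega> \<in> carrier (\<Omega> n)" using \<omega> by (simp add: cocycles_def)
  obtain q where q: "q \<in> module_hom K (\<Omega> n) ?H"
    "\<And>z. z \<in> cocycles \<Omega> d n \<Longrightarrow> q z = cohomology_class \<Omega> d n z"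
    using complex.cohomology_class_extension[OF field_axioms] by blast
  have "average n \<omega> \<in> cocycles \<Omega> d n"
    using average_cocycle[OF \<omega>] by (auto simp: cocycles_def invariant_forms_def coinvariants_def)
  then have "cohomology_class \<Omega> d n (average n \<omega>) = q (slice K P I (\<Omega> n) (coact n \<omega>))"
    using q(2) by (simp add: average_def)
  also have "\<dots> = slice K P I ?H (tensor_map K P (\<Omega> n) P ?H id q (coact n \<omega>))"
    by (rule slice_tensor_map[OF P F H integral(2) q(1) coact_closed[OF \<omega>c], symmetric])
  also have "tensor_map K P (\<Omega> n) P ?H id q (coact n \<omega>) =
      pure K P ?H \<one>\<^bsub>P\<^esub> (cohomology_class \<Omega> d n \<omega>)"
    using inv cohomology_coaction_class[OF q \<omega>] by (simp add: coinvariants_def)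
  also have "slice K P I ?H \<dots> = cohomology_class \<Omega> d n \<omega>"
    by (rule integral_slice_one[OF P H one_closed I]) (use inv in \<open>simp add: coinvariants_def\<close>)
  finally show ?thesis .
qed

lemma inclusion_iso:
  "cohomology_map inv_forms d \<Omega> d (\<lambda>m \<omega>. \<omega>) n
    \<in> module_iso K (cohomology inv_forms d n) (invariant_cohomology K P \<Omega> d \<Delta>s n)"
proof -
  interpret i: cochain_map K inv_forms d \<Omega> d "\<lambda>m \<omega>. \<omega>" by (rule inclusion_cochain_map)
  let ?h = "cohomology_map inv_forms d \<Omega> d (\<lambda>m \<omega>. \<omega>) n"
  let ?D = "coinvariants K P (cohomology \<Omega> d n) (cohomology_coaction K P \<Omega> d \<Delta>s n)"
  have D: "carrier (invariant_cohomology K P \<Omega> d \<Delta>s n) = ?D"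
    by (simp add: invariant_cohomology_def)
  have into: "?h X \<in> ?D" if "X \<in> carrier (cohomology inv_forms d n)" for X
    using that coaction_invariant_class by (auto simp: i.C.carrier_cohomology i.cohomology_map_class)
  have hom: "?h \<in> module_hom K (cohomology inv_forms d n) (invariant_cohomology K P \<Omega> d \<Delta>s n)"
    by (rule module_homI)
      (simp_all add: D into, simp_all add: invariant_cohomology_def module_homD[OF i.cohomology_map_hom])
  have sub: "cocycles inv_forms d n \<subseteq> cocycles \<Omega> d n" using i.map_cocycle by blast
  have "inj_on ?h (carrier (cohomology inv_forms d n))"
  proof (rule inj_onI)
    fix X Y assume "X \<in> carrier (cohomology inv_forms d n)" "Y \<in> carrier (cohomology inv_forms d n)"
    then obtain x y where x: "x \<in> cocycles inv_forms d n" "X = cohomology_class inv_forms d n x"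
      and y: "y \<in> cocycles inv_forms d n" "Y = cohomology_class inv_forms d n y"
      by (auto simp: i.C.carrier_cohomology)
    assume "?h X = ?h Y"
    then have "cohomology_class \<Omega> d n x = cohomology_class \<Omega> d n y"
      using x y by (simp add: i.cohomology_map_class)
    then obtain b where b: "b \<in> coboundaries \<Omega> d n" "x = b \<oplus>\<^bsub>\<Omega> n\<^esub> y"
      using complex.cohomology_class_eq_iff[OF subsetD[OF sub x(1)] subsetD[OF sub y(1)]] by blast
    have cl: "b \<in> carrier (\<Omega> n)" "y \<in> carrier (\<Omega> n)" "x \<in> carrier (inv_forms n)" "y \<in> carrier (inv_forms n)"
      using b(1) complex.coboundaries_subset x y sub by (auto simp: cocycles_def)
    \<comment> \<open>Averaging the relation \<open>x = b + y\<close> fixes the invariant forms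
      \<open>x\<close> and \<open>y\<close> and replaces \<open>b\<close> by its average, which is a
      coboundary among invariant forms.\<close>
    have "x = average n b \<oplus>\<^bsub>inv_forms n\<^esub> y"
      using average_id[OF cl(3)] average_id[OF cl(4)] b(2) module_homD(2)[OF average_hom cl(1,2)]
      by (simp add: invariant_forms_def)
    moreover have "average n b \<in> coboundaries inv_forms d n"
    proof (cases n)
      case 0
      then show ?thesis
        using b(1) module_hom_zero[OF forms_module forms_module average_hom]
        by (simp add: coboundaries_def invariant_forms_def)
    next
      case (Suc m)
      then obtain \<eta> where "\<eta> \<in> carrier (\<Omega> m)" "b = d m \<eta>" using b(1) by (auto simp: coboundaries_def)
      then show ?thesis
        using average_d average_coinvariant Suc by (auto simp: coboundaries_def)
    qed
    ultimately show "X = Y"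
      using i.C.cohomology_class_eq_iff[OF x(1) y(1)] x(2) y(2) by auto
  qed
  \<comment> \<open>Surjectivity: the average of any representative of an invariant class is an
    invariant cocycle in that class.\<close>
  moreover have "?D \<subseteq> ?h ` carrier (cohomology inv_forms d n)"
  proof
    fix X assume X: "X \<in> ?D"
    then obtain \<omega> where \<omega>: "\<omega> \<in> cocycles \<Omega> d n" "X = cohomology_class \<Omega> d n \<omega>"
      by (auto simp: coinvariants_def complex.carrier_cohomology)
    have "X = ?h (cohomology_class inv_forms d n (average n \<omega>))"
      using average_class[OF \<omega>(1)] X \<omega> by (simp add: i.cohomology_map_class average_cocycle)
    then show "X \<in> ?h ` carrier (cohomology inv_forms d n)"
      using average_cocycle[OF \<omega>(1)] by (auto simp: i.C.carrier_cohomology)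
  qed
  ultimately show ?thesis
    using hom into by (auto simp: module_iso_def bij_betw_def D)
qed

end

end

theorem corollary3p5:
  fixes K :: "'k ring" and P :: "('k, 'a) module"
    and \<Delta> :: "'a \<Rightarrow> ('k, 'a, 'a) tensor" and \<epsilon> :: "'a \<Rightarrow> 'k" and S :: "'a \<Rightarrow> 'a"
    and \<Omega> :: "nat \<Rightarrow> ('k, 'a) module"
    and w :: "nat \<Rightarrow> nat \<Rightarrow> 'a \<Rightarrow> 'a \<Rightarrow> 'a"
    and d :: "nat \<Rightarrow> 'a \<Rightarrow> 'a"
    and \<Delta>s :: "nat \<Rightarrow> 'a \<Rightarrow> nat \<Rightarrow> ('k, 'a, 'a) tensor"
  assumes "bicovariant_calculus K P \<Delta> \<epsilon> S \<Omega> w d \<Delta>s"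
    and "\<exists>I. normalised_left_integral K P \<Delta> I"
  shows "(\<forall>n. cohomology_map (invariant_forms K P \<Omega> \<Delta>s) d \<Omega> d (\<lambda>m \<omega>. \<omega>) n
              \<in> module_iso K (cohomology (invariant_forms K P \<Omega> \<Delta>s) d n)
                              (invariant_cohomology K P \<Omega> d \<Delta>s n)) \<and>
         (connected_calculus K P \<Omega> d \<longrightarrow>
            (\<forall>n. coinvariants K P (cohomology \<Omega> d n) (cohomology_coaction K P \<Omega> d \<Delta>s n) =
                 carrier (cohomology \<Omega> d n)))"
proof -
  interpret bicovariant_calculus K P \<Delta> \<epsilon> S \<Omega> w d \<Delta>s by fact
  show ?thesis using assms(2) inclusion_iso connected_coinvariants by blast
qed

end
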